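(* Let $k$ be a field. For each finite Kolmogoroff space $X$, let $R(X)\subset F(X)=\prod_{x\in X}k(T_U)_{U\ni x}$ be the ring defined in the context, and let $$g_X:X\longrightarrow \operatorname{Spec}(R(X)),\qquad a\longmapsto \operatorname{Ker}(\operatorname{pr}_a|_{R(X)})$$ where $\operatorname{pr}_a:F(X)\to k(T_U)_{U\ni a}$ is the projection. Then $g_X$ is a homeomorphism for every finite Kolmogoroff space $X$. Moreover, the formation of $R(X)$ is (contravariantly) functorial, and $g_X$ is natural, both with respect to continuous surjections of finite Kolmogoroff spaces. That is: for each continuous surjection $f:X\to Y$ of finite Kolmogoroff spaces the homomorphism $f^*:F(Y)\to F(X)$ restricts to a ring homomorphism $f^*:R(Y)\to R(X)$, these restrictions are compatible with identities and compositions, and $\operatorname{Spec}(f^* )\circ g_X=g_Y\circ f$.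
   Context: Rings are commutative with unit. A topological space is Kolmogoroff ($T_0$) if for each pair of points $a\ne b$ there is an open set containing exactly one of them. Fix a field $k$. Let $X$ be a finite Kolmogoroff space. For each open set $U\subset X$ choose a formal symbol $T_U$. For $x\in X$, $k(T_U)_{U\ni x}$ denotes the rational function field over $k$ in indeterminates $T_U$ indexed by the open neighborhoods $U$ of $x$. Put $F(X)=\prod_{x\in X}k(T_U)_{U\ni x}$. For a continuous surjection $f:X\to Y$ of finite Kolmogoroff spaces, $f^*:F(Y)\to F(X)$ sends $(Q_y)_{y\in Y}$ to the tuple $(P_x)_{x\in X}$ where $P_x$ is the image of $Q_{f(x)}$ under the $k$-homomorphism of fields $k(T_V)_{V\ni f(x)}\to k(T_U)_{U\ni x}$, $T_V\mapsto T_{f^{-1}(V)}$ (well defined since by surjectivity of $f$ the sets $f^{-1}(V)$ are pairwise different). For $x\in X$ and $\sigma\in\overline{\{x\}}$ with $\sigma\neq x$, let $K_{x,\sigma}\subset k(T_U)_{U\ni x}$ be the subfield generated over $k$ by all $T_U$ with $U$ open, $\sigma\in U$ (such $U$ also contain $x$), and all quotients $T_{U'}/T_{U''}$ with $U',U''$ open sets containing $x$ but not $\sigma$. Choose an open set $U_x$ containing $x$ but not $\sigma$, and let $R^x_\sigma\subset k(T_U)_{U\ni x}$ be the localization of the polynomial ring $K_{x,\sigma}[T_{U_x}]$ at the maximal ideal $(T_{U_x})$. This is a discrete valuation ring with uniformizer $T_{U_x}$, residue field $K_{x,\sigma}$, and field of fractions $k(T_U)_{U\ni x}$, and does not depend on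 the choice of $U_x$. Note $k(T_U)_{U\ni\sigma}\subset K_{x,\sigma}$. Set $R^x=\bigcap_{\sigma\in\overline{\{x\}}\smallsetminus\{x\}}R^x_\sigma$, understood as the field $k(T_U)_{U\ni x}$ if $x$ is a closed point. For non-closed $x$ this is a semilocal Dedekind domain with $R^x/\operatorname{Jac}(R^x)=\prod_{\sigma\in\overline{\{x\}}\smallsetminus\{x\}}K_{x,\sigma}$, where $\operatorname{Jac}$ denotes the Jacobson radical. The ring $R(X)\subset\prod_{x\in X}R^x\subset F(X)$ is the subring of all tuples $(P_x)_{x\in X}$ such that for each non-closed $x\in X$ the residue class of $P_x$ in $R^x/\operatorname{Jac}(R^x)=\prod_{\sigma\in\overline{\{x\}}\smallsetminus\{x\}}K_{x,\sigma}$ equals $(P_\sigma)_{\sigma\in\overline{\{x\}}\smallsetminus\{x\}}$, where $P_\sigma\in R^\sigma\subset k(T_U)_{U\ni\sigma}\subset K_{x,\sigma}$. *)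

theory Defs
  imports
    "HOL-Analysis.Analysis"
    "HOL-Library.Poly_Mapping"
    "HOL-Computational_Algebra.Fraction_Field"
    "HOL-Algebra.Generated_Fields"
    "HOL-Algebra.Algebraic_Closure_Type"
begin

section \<open>Rational functions in arbitrarily many indeterminates\<close>

text \<open>
  The \<^emph>\<open>idom\<close> instance of the type of polynomial mappings needs a linear order on the exponents,
  hence on the indeterminates. Here the indeterminates are indexed by sets, so polynomials get
  their own type, which is an integral domain for every type of indeterminates.
\<close>

typedef (overloaded) ('v, 'k) mpoly = "UNIV :: (('v \<Rightarrow>\<^sub>0 nat) \<Rightarrow>\<^sub>0 'k::zero) set"
  by simp

setup_lifting type_definition_mpoly

lemma finite_sets_unique_sum:
  fixes V :: "'v set" and A B :: "('v \<Rightarrow>\<^sub>0 nat) set"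
  assumes "finite V" "finite A" "finite B" "A \<noteq> {}" "B \<noteq> {}"
    and "\<And>a a' v. \<lbrakk>a \<in> A; a' \<in> A; v \<notin> V\<rbrakk> \<Longrightarrow> Poly_Mapping.lookup a v = Poly_Mapping.lookup a' v"
    and "\<And>b b' v. \<lbrakk>b \<in> B; b' \<in> B; v \<notin> V\<rbrakk> \<Longrightarrow> Poly_Mapping.lookup b v = Poly_Mapping.lookup b' v"
  shows "\<exists>a\<in>A. \<exists>b\<in>B. \<forall>a'\<in>A. \<forall>b'\<in>B. a' + b' = a + b \<longrightarrow> a' = a \<and> b' = b"
  using assms
proof (induction V arbitrary: A B rule: finite_induct)
  case empty
  then obtain a b where ab: "a \<in> A" "b \<in> B"
    by blast
  have "a' = a" if "a' \<in> A" for a'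
    using empty(5)[OF that ab(1)] by (simp add: poly_mapping_eq_iff fun_eq_iff)
  moreover have "b' = b" if "b' \<in> B" for b'
    using empty(6)[OF that ab(2)] by (simp add: poly_mapping_eq_iff fun_eq_iff)
  ultimately show ?case
    using ab by blast
next
  case (insert v V)
  define m where "m C = Max ((\<lambda>c. Poly_Mapping.lookup c v) ` C)" for C :: "('v \<Rightarrow>\<^sub>0 nat) set"
  define top where "top C = {c \<in> C. Poly_Mapping.lookup c v = m C}" for C
  have le: "Poly_Mapping.lookup c v \<le> m C" if "finite C" "c \<in> C" for c C
    using that unfolding m_def by auto
  have ne: "top C \<noteq> {}" if "finite C" "C \<noteq> {}" for C
  proof -
    have "m C \<in> (\<lambda>c. Poly_Mapping.lookup c v) ` C"
      unfolding m_def using that by (intro Max_in) auto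
    then show ?thesis
      unfolding top_def by force
  qed
  have "\<exists>a\<in>top A. \<exists>b\<in>top B. \<forall>a'\<in>top A. \<forall>b'\<in>top B. a' + b' = a + b \<longrightarrow> a' = a \<and> b' = b"
  proof (rule insert.IH)
    show "Poly_Mapping.lookup a w = Poly_Mapping.lookup a' w"
      if "a \<in> top A" "a' \<in> top A" "w \<notin> V" for a a' w
      using that insert.prems(5)[of a a' w] by (cases "w = v") (auto simp: top_def)
    show "Poly_Mapping.lookup b w = Poly_Mapping.lookup b' w"
      if "b \<in> top B" "b' \<in> top B" "w \<notin> V" for b b' w
      using that insert.prems(6)[of b b' w] by (cases "w = v") (auto simp: top_def)
    show "finite (top A)" "finite (top B)"
      using insert.prems(1,2) by (simp_all add: top_def)
    show "top A \<noteq> {}" "top B \<noteq> {}"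
      using insert.prems(1-4) ne by blast+
  qed
  then obtain a b where ab: "a \<in> top A" "b \<in> top B"
    and uniq: "\<And>a' b'. \<lbrakk>a' \<in> top A; b' \<in> top B; a' + b' = a + b\<rbrakk> \<Longrightarrow> a' = a \<and> b' = b"
    by blast
  have "a' = a \<and> b' = b" if *: "a' \<in> A" "b' \<in> B" "a' + b' = a + b" for a' b'
  proof -
    have "Poly_Mapping.lookup a' v + Poly_Mapping.lookup b' v = m A + m B"
      using arg_cong[OF *(3), of "\<lambda>c. Poly_Mapping.lookup c v"] ab
      by (simp add: lookup_add top_def)
    then have "a' \<in> top A" "b' \<in> top B"
      using le[OF insert.prems(1) *(1)] le[OF insert.prems(2) *(2)] * by (auto simp: top_def)
    then show ?thesis
      using uniq *(3) by blast
  qed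
  then show ?case
    using ab unfolding top_def by blast
qed

lemma poly_mapping_mult_nonzero:
  fixes p q :: "('v \<Rightarrow>\<^sub>0 nat) \<Rightarrow>\<^sub>0 'k::semiring_no_zero_divisors"
  assumes "p \<noteq> 0" "q \<noteq> 0"
  shows "p * q \<noteq> 0"
proof -
  define V where "V = (\<Union>a \<in> Poly_Mapping.keys p \<union> Poly_Mapping.keys q. Poly_Mapping.keys a)"
  have "\<exists>a\<in>Poly_Mapping.keys p. \<exists>b\<in>Poly_Mapping.keys q.
      \<forall>a'\<in>Poly_Mapping.keys p. \<forall>b'\<in>Poly_Mapping.keys q. a' + b' = a + b \<longrightarrow> a' = a \<and> b' = b"
  proof (rule finite_sets_unique_sum[of V])
    show "finite V"
      unfolding V_def by (intro finite_UN_I finite_UnI finite_keys)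
    show "Poly_Mapping.keys p \<noteq> {}" "Poly_Mapping.keys q \<noteq> {}"
      using assms by (metis keys_eq_empty)+
    show "Poly_Mapping.lookup a v = Poly_Mapping.lookup a' v"
      if "a \<in> Poly_Mapping.keys p" "a' \<in> Poly_Mapping.keys p" "v \<notin> V" for a a' v
      using that unfolding V_def by (metis UN_I UnI1 in_keys_iff)
    show "Poly_Mapping.lookup b v = Poly_Mapping.lookup b' v"
      if "b \<in> Poly_Mapping.keys q" "b' \<in> Poly_Mapping.keys q" "v \<notin> V" for b b' v
      using that unfolding V_def by (metis UN_I UnI2 in_keys_iff)
  qed (rule finite_keys)+
  then obtain a b where a: "a \<in> Poly_Mapping.keys p" and b: "b \<in> Poly_Mapping.keys q"
    and uniq: "\<And>a' b'. \<lbrakk>a' \<in> Poly_Mapping.keys p; b' \<in> Poly_Mapping.keys q; a' + b' = a + b\<rbrakk>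
      \<Longrightarrow> a' = a \<and> b' = b"
    by blast
  let ?f = "Poly_Mapping.lookup p" and ?g = "Poly_Mapping.lookup q"
  have "Poly_Mapping.lookup (p * q) (a + b) = (\<Sum>(a', b'). ?f a' * ?g b' when a + b = a' + b')"
    by (simp add: times_poly_mapping.rep_eq prod_fun_unfold_prod)
  also have "\<dots> = (\<Sum>c. ?f a * ?g b when c = (a, b))"
  proof (rule Sum_any.cong)
    fix c :: "('v \<Rightarrow>\<^sub>0 nat) \<times> ('v \<Rightarrow>\<^sub>0 nat)"
    obtain a' b' where c: "c = (a', b')"
      by (cases c)
    show "(case c of (a', b') \<Rightarrow> ?f a' * ?g b' when a + b = a' + b') = (?f a * ?g b when c = (a, b))"
    proof (cases "a' \<in> Poly_Mapping.keys p \<and> b' \<in> Poly_Mapping.keys q \<and> a + b = a' + b'")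
      case True
      then show ?thesis
        using uniq[of a' b'] c by simp
    next
      case False
      then have "(a', b') \<noteq> (a, b)"
        using a b by auto
      then show ?thesis
        using False c by (auto simp: when_def in_keys_iff)
    qed
  qed
  also have "\<dots> = ?f a * ?g b"
    by simp
  finally have "Poly_Mapping.lookup (p * q) (a + b) \<noteq> 0"
    using a b by (simp add: in_keys_iff)
  then show ?thesis
    by auto
qed

instantiation mpoly :: (type, idom) idom
begin

lift_definition zero_mpoly :: "('v, 'k::idom) mpoly" is 0 .
lift_definition one_mpoly :: "('v, 'k::idom) mpoly" is 1 .
lift_definition plus_mpoly :: "('v, 'k::idom) mpoly \<Rightarrow> ('v, 'k) mpoly \<Rightarrow> ('v, 'k) mpoly" is "(+)" .
lift_definition minus_mpoly :: "('v, 'k::idom) mpoly \<Rightarrow> ('v, 'k) mpoly \<Rightarrow> ('v, 'k) mpoly" is "(-)" .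
lift_definition uminus_mpoly :: "('v, 'k::idom) mpoly \<Rightarrow> ('v, 'k) mpoly" is uminus .
lift_definition times_mpoly :: "('v, 'k::idom) mpoly \<Rightarrow> ('v, 'k) mpoly \<Rightarrow> ('v, 'k) mpoly" is "(*)" .

instance
  by standard
    (transfer; simp add: algebra_simps poly_mapping_mult_nonzero)+

end

type_synonym ('v, 'k) ratfun = "('v, 'k) mpoly fract"

lift_definition mpoly_const :: "'k::idom \<Rightarrow> ('v, 'k) mpoly"
  is "\<lambda>c. Poly_Mapping.single 0 c" .

lift_definition mpoly_var :: "'v \<Rightarrow> ('v, 'k::idom) mpoly"
  is "\<lambda>v. Poly_Mapping.single (Poly_Mapping.single v 1) 1" .

definition const :: "'k::field \<Rightarrow> ('v, 'k) ratfun" where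
  "const c = Fract (mpoly_const c) 1"

definition indet :: "'v \<Rightarrow> ('v, 'k::field) ratfun" where
  "indet v = Fract (mpoly_var v) 1"

abbreviation ratfun_ring :: "('v, 'k::field) ratfun ring" where
  "ratfun_ring \<equiv> ring_of_type_algebra"

definition adjoin :: "('v, 'k::field) ratfun set \<Rightarrow> ('v, 'k) ratfun set" where
  "adjoin S = generate_field ratfun_ring (const ` UNIV \<union> S)"

section \<open>General notions from commutative algebra\<close>

text \<open>The Zariski topology; by the lemma below its points are all prime ideals.\<close>

definition Spec :: "('r, 'm) ring_scheme \<Rightarrow> 'r set topology" where
  "Spec A = topology (\<lambda>\<U>. \<exists>S\<subseteq>carrier A. \<U> = {\<pp>. primeideal \<pp> A \<and> \<not> S \<subseteq> \<pp>})"

lemma openin_Spec: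
  "openin (Spec A) \<U> \<longleftrightarrow> (\<exists>S\<subseteq>carrier A. \<U> = {\<pp>. primeideal \<pp> A \<and> \<not> S \<subseteq> \<pp>})"
proof -
  let ?D = "\<lambda>S. {\<pp>. primeideal \<pp> A \<and> \<not> S \<subseteq> \<pp>}"
  have "istopology (\<lambda>\<U>. \<exists>S\<subseteq>carrier A. \<U> = ?D S)"
    unfolding istopology_def
  proof (intro conjI allI impI)
    fix \<U> \<V>
    assume "\<exists>S\<subseteq>carrier A. \<U> = ?D S" "\<exists>S\<subseteq>carrier A. \<V> = ?D S"
    then obtain S T where S: "S \<subseteq> carrier A" "\<U> = ?D S" and T: "T \<subseteq> carrier A" "\<V> = ?D T"
      by blast
    let ?W = "{s \<otimes>\<^bsub>A\<^esub> t | s t. s \<in> S \<and> t \<in> T \<and> s \<otimes>\<^bsub>A\<^esub> t \<in> carrier A}"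
    have "\<not> ?W \<subseteq> \<pp> \<longleftrightarrow> \<not> S \<subseteq> \<pp> \<and> \<not> T \<subseteq> \<pp>" if p: "primeideal \<pp> A" for \<pp>
    proof -
      interpret primeideal \<pp> A by (rule p)
      show ?thesis
      proof
        assume "\<not> ?W \<subseteq> \<pp>"
        then obtain s t where st: "s \<in> S" "t \<in> T" "s \<otimes>\<^bsub>A\<^esub> t \<notin> \<pp>"
          by blast
        moreover have "s \<in> carrier A" "t \<in> carrier A"
          using st S(1) T(1) by auto
        ultimately have "s \<notin> \<pp>" "t \<notin> \<pp>"
          using I_l_closed I_r_closed by blast+
        then show "\<not> S \<subseteq> \<pp> \<and> \<not> T \<subseteq> \<pp>"
          using st by blast
      next
        assume "\<not> S \<subseteq> \<pp> \<and> \<not> T \<subseteq> \<pp>"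
        then obtain s t where st: "s \<in> S" "t \<in> T" "s \<notin> \<pp>" "t \<notin> \<pp>"
          by blast
        then have "s \<in> carrier A" "t \<in> carrier A"
          using S(1) T(1) by auto
        then have "s \<otimes>\<^bsub>A\<^esub> t \<notin> \<pp>" "s \<otimes>\<^bsub>A\<^esub> t \<in> carrier A"
          using I_prime st by auto
        then show "\<not> ?W \<subseteq> \<pp>"
          using st by blast
      qed
    qed
    then have "\<U> \<inter> \<V> = ?D ?W"
      unfolding S(2) T(2) by blast
    moreover have "?W \<subseteq> carrier A"
      by blast
    ultimately show "\<exists>S\<subseteq>carrier A. \<U> \<inter> \<V> = ?D S"
      by blast
  next
    fix \<K>
    assume "\<forall>\<U>\<in>\<K>. \<exists>S\<subseteq>carrier A. \<U> = ?D S"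
    then obtain s where s: "\<And>\<U>. \<U> \<in> \<K> \<Longrightarrow> s \<U> \<subseteq> carrier A \<and> \<U> = ?D (s \<U>)"
      by metis
    have "(\<Union>\<U>\<in>\<K>. \<U>) = (\<Union>\<U>\<in>\<K>. ?D (s \<U>))"
      by (rule SUP_cong[OF refl]) (rule s[THEN conjunct2])
    also have "\<dots> = ?D (\<Union>\<U>\<in>\<K>. s \<U>)"
      by blast
    finally have "\<Union>\<K> = ?D (\<Union>\<U>\<in>\<K>. s \<U>)"
      by simp
    moreover have "(\<Union>\<U>\<in>\<K>. s \<U>) \<subseteq> carrier A"
      by (rule UN_least) (rule s[THEN conjunct1])
    ultimately show "\<exists>S\<subseteq>carrier A. \<Union>\<K> = ?D S"
      by blast
  qed
  then show ?thesis
    unfolding Spec_def by (simp add: topology_inverse')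
qed

lemma topspace_Spec: "topspace (Spec A) = {\<pp>. primeideal \<pp> A}"
proof
  show "topspace (Spec A) \<subseteq> {\<pp>. primeideal \<pp> A}"
    unfolding topspace_def openin_Spec by blast
  have "\<not> carrier A \<subseteq> \<pp>" if "primeideal \<pp> A" for \<pp>
    using primeideal.I_notcarr[OF that] additive_subgroup.a_subset[of \<pp> A]
      ideal.axioms(1)[OF primeideal.axioms(1)[OF that]] by blast
  then have "openin (Spec A) {\<pp>. primeideal \<pp> A}"
    unfolding openin_Spec by (intro exI[of _ "carrier A"]) auto
  then show "{\<pp>. primeideal \<pp> A} \<subseteq> topspace (Spec A)"
    by (rule openin_subset)
qed

definition Spec_map :: "('r, 'm) ring_scheme \<Rightarrow> ('r \<Rightarrow> 's) \<Rightarrow> 's set \<Rightarrow> 'r set" where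
  "Spec_map A h \<pp> = {a \<in> carrier A. h a \<in> \<pp>}"

definition Jac :: "('r, 'm) ring_scheme \<Rightarrow> 'r set" where
  "Jac A = {a \<in> carrier A. \<forall>\<mm>. maximalideal \<mm> A \<longrightarrow> a \<in> \<mm>}"

definition prod_ring :: "'i set \<Rightarrow> ('i \<Rightarrow> ('r, 'm) ring_scheme) \<Rightarrow> ('i \<Rightarrow> 'r) ring" where
  "prod_ring I A = \<lparr>
     carrier = (\<Pi>\<^sub>E i\<in>I. carrier (A i)),
     monoid.mult = (\<lambda>P Q. \<lambda>i\<in>I. P i \<otimes>\<^bsub>A i\<^esub> Q i),
     one = (\<lambda>i\<in>I. \<one>\<^bsub>A i\<^esub>),
     ring.zero = (\<lambda>i\<in>I. \<zero>\<^bsub>A i\<^esub>),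
     add = (\<lambda>P Q. \<lambda>i\<in>I. P i \<oplus>\<^bsub>A i\<^esub> Q i)\<rparr>"

section \<open>The ring attached to a finite Kolmogoroff space\<close>

definition finite_kolmogoroff :: "'a topology \<Rightarrow> bool" where
  "finite_kolmogoroff \<X> \<longleftrightarrow> finite (topspace \<X>) \<and> t0_space \<X>"

definition continuous_surjection :: "'a topology \<Rightarrow> 'b topology \<Rightarrow> ('a \<Rightarrow> 'b) \<Rightarrow> bool" where
  "continuous_surjection \<X> \<Y> f \<longleftrightarrow> continuous_map \<X> \<Y> f \<and> f ` topspace \<X> = topspace \<Y>"

text \<open>
  All the fields below are realized inside one ambient field, the rational function field over \<open>'k\<close>
  with one indeterminate \<open>indet U\<close> for every set \<open>U\<close> of elements of the carrier type; only those
  with \<open>U\<close> open in \<open>\<X>\<close> occur. This turns the canonical embeddings between the fields into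
  inclusions. (The plain letter \<open>X\<close> is notation of the imported theory of polynomials.)
\<close>

definition point_field :: "'a topology \<Rightarrow> 'a \<Rightarrow> ('a set, 'k::field) ratfun set" where
  "point_field \<X> x = adjoin {indet U | U. openin \<X> U \<and> x \<in> U}"

abbreviation point_ring :: "'a topology \<Rightarrow> 'a \<Rightarrow> ('a set, 'k::field) ratfun ring" where
  "point_ring \<X> x \<equiv> ratfun_ring\<lparr>carrier := point_field \<X> x\<rparr>"

definition F_ring :: "'k::field itself \<Rightarrow> 'a topology \<Rightarrow> ('a \<Rightarrow> ('a set, 'k) ratfun) ring" where
  "F_ring k \<X> = prod_ring (topspace \<X>) (point_ring \<X>)"

definition specializations :: "'a topology \<Rightarrow> 'a \<Rightarrow> 'a set" where
  "specializations \<X> x = \<X> closure_of {x} - {x}"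

definition res_field :: "'a topology \<Rightarrow> 'a \<Rightarrow> 'a \<Rightarrow> ('a set, 'k::field) ratfun set" where
  "res_field \<X> x s = adjoin
     ({indet U | U. openin \<X> U \<and> s \<in> U} \<union>
      {indet U / indet V | U V. openin \<X> U \<and> x \<in> U \<and> s \<notin> U \<and> openin \<X> V \<and> x \<in> V \<and> s \<notin> V})"

text \<open>
  For \<open>s \<in> specializations \<X> x\<close> in a Kolmogoroff space an open set as below exists, and \<open>dvr\<close> and
  its maximal ideal do not depend on which one is chosen.
\<close>

definition unif :: "'a topology \<Rightarrow> 'a \<Rightarrow> 'a \<Rightarrow> ('a set, 'k::field) ratfun" where
  "unif \<X> x s = indet (SOME U. openin \<X> U \<and> x \<in> U \<and> s \<notin> U)"

definition res_poly_ring :: "'a topology \<Rightarrow> 'a \<Rightarrow> 'a \<Rightarrow> ('a set, 'k::field) ratfun ring" where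
  "res_poly_ring \<X> x s =
     ratfun_ring\<lparr>carrier := generate_ring ratfun_ring (res_field \<X> x s \<union> {unif \<X> x s})\<rparr>"

definition dvr :: "'a topology \<Rightarrow> 'a \<Rightarrow> 'a \<Rightarrow> ('a set, 'k::field) ratfun ring" where
  "dvr \<X> x s = ratfun_ring\<lparr>carrier := {a / b | a b.
     a \<in> carrier (res_poly_ring \<X> x s) \<and>
     b \<in> carrier (res_poly_ring \<X> x s) - PIdl\<^bsub>res_poly_ring \<X> x s\<^esub> (unif \<X> x s)}\<rparr>"

text \<open>
  The residue field of \<open>dvr \<X> x s\<close> is identified with \<open>res_field \<X> x s\<close>, which is a set of
  representatives of the residue classes: \<open>residue\<close> picks the representative.
\<close>

definition residue ::
    "'a topology \<Rightarrow> 'a \<Rightarrow> 'a \<Rightarrow> ('a set, 'k::field) ratfun \<Rightarrow> ('a set, 'k) ratfun" where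
  "residue \<X> x s P = (THE c. c \<in> res_field \<X> x s \<and> P - c \<in> PIdl\<^bsub>dvr \<X> x s\<^esub> (unif \<X> x s))"

text \<open>If \<open>x\<close> is closed, then the index set is empty and \<open>local_ring \<X> x\<close> is the whole field.\<close>

definition local_ring :: "'a topology \<Rightarrow> 'a \<Rightarrow> ('a set, 'k::field) ratfun ring" where
  "local_ring \<X> x = ratfun_ring\<lparr>carrier :=
     point_field \<X> x \<inter> (\<Inter>s\<in>specializations \<X> x. carrier (dvr \<X> x s))\<rparr>"

definition residues ::
    "'a topology \<Rightarrow> 'a \<Rightarrow> ('a set, 'k::field) ratfun \<Rightarrow> 'a \<Rightarrow> ('a set, 'k) ratfun" where
  "residues \<X> x P = (\<lambda>s\<in>specializations \<X> x. residue \<X> x s P)"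

text \<open>
  The canonical isomorphism from \<open>local_ring \<X> x Quot Jac (local_ring \<X> x)\<close> onto the product of the
  residue fields, i.e. the map induced on cosets by \<open>residues\<close>; \<open>the_elem (h ` C)\<close> is the library's
  form of the induced map, see \<open>ring_hom_ring.FactRing_iso_set\<close>.
\<close>

definition jac_quot_iso ::
    "'a topology \<Rightarrow> 'a \<Rightarrow> ('a set, 'k::field) ratfun set \<Rightarrow> 'a \<Rightarrow> ('a set, 'k) ratfun" where
  "jac_quot_iso \<X> x C = the_elem (residues \<X> x ` C)"

definition R_ring :: "'k::field itself \<Rightarrow> 'a topology \<Rightarrow> ('a \<Rightarrow> ('a set, 'k) ratfun) ring" where
  "R_ring k \<X> = (F_ring k \<X>)\<lparr>carrier := {P \<in> \<Pi>\<^sub>E x\<in>topspace \<X>. carrier (local_ring \<X> x).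
     \<forall>x\<in>topspace \<X>. \<not> closedin \<X> {x} \<longrightarrow>
       jac_quot_iso \<X> x (Jac (local_ring \<X> x) +>\<^bsub>local_ring \<X> x\<^esub> P x)
         = restrict P (specializations \<X> x)}\<rparr>"

definition spec_point ::
    "'k::field itself \<Rightarrow> 'a topology \<Rightarrow> 'a \<Rightarrow> ('a \<Rightarrow> ('a set, 'k) ratfun) set" where
  "spec_point k \<X> a = a_kernel (R_ring k \<X>) (point_ring \<X> a) (\<lambda>P. P a)"

definition point_hom :: "'a topology \<Rightarrow> 'b topology \<Rightarrow> ('a \<Rightarrow> 'b) \<Rightarrow> 'a
    \<Rightarrow> ('b set, 'k::field) ratfun \<Rightarrow> ('a set, 'k) ratfun" where
  "point_hom \<X> \<Y> f x = (THE \<phi>.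
     \<phi> \<in> extensional (point_field \<Y> (f x)) \<and>
     \<phi> \<in> ring_hom (point_ring \<Y> (f x)) (point_ring \<X> x) \<and>
     (\<forall>c. \<phi> (const c) = const c) \<and>
     (\<forall>V. openin \<Y> V \<and> f x \<in> V \<longrightarrow> \<phi> (indet V) = indet {u \<in> topspace \<X>. f u \<in> V}))"

definition pullback :: "'a topology \<Rightarrow> 'b topology \<Rightarrow> ('a \<Rightarrow> 'b)
    \<Rightarrow> ('b \<Rightarrow> ('b set, 'k::field) ratfun) \<Rightarrow> 'a \<Rightarrow> ('a set, 'k) ratfun" where
  "pullback \<X> \<Y> f Q = (\<lambda>x\<in>topspace \<X>. point_hom \<X> \<Y> f x (Q (f x)))"

end

theory Submission
  imports Defs "HOL-Computational_Algebra.Formal_Laurent_Series" "HOL-Computational_Algebra.Polynomial_FPS"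
begin

text \<open>
  For \<open>s\<close> in the closure of \<open>x\<close>, substituting \<open>T\<^sub>U z\<close> for every \<open>T\<^sub>U\<close> with \<open>s \<notin> U\<close> embeds the rational functions
  into Laurent series in \<open>z\<close>; the discrete valuation ring at \<open>(x, s)\<close> consists of the functions with
  regular image, and the residue is the constant coefficient. Thus an element of the ring of \<open>\<X>\<close> is a
  family \<open>P\<close> such that \<open>P\<^sub>x\<close> is integral at \<open>s\<close> with constant coefficient \<open>P\<^sub>s\<close>. For \<open>U\<close> open, the family
  that is \<open>T\<^sub>U\<close> on \<open>U\<close> and \<open>0\<close> elsewhere is such an element, so the kernels of the projections form a
  copy of \<open>\<X>\<close> in the spectrum. There are no further primes: a family without zeros is a unit, and so a
  prime \<open>p\<close> lies in the kernel at some \<open>a\<close>; if \<open>a\<close> is as generic as possible, then \<open>p\<close> contains some \<open>Q\<close>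
  without zeros on the proper generizations of \<open>a\<close>, and if \<open>P\<close> vanishes at \<open>a\<close>, then a power of \<open>P\<close> times
  an element outside \<open>p\<close> is a multiple of \<open>Q\<close>.
\<close>

section \<open>Evaluation of polynomials and rational functions\<close>

text \<open>The definitions reach the ring through a chosen separating set, a localization, a
  \<open>THE\<close> and cosets of a Jacobson radical. The two functions \<open>val s\<close> and
  \<open>reduct s\<close> replace all of this; they depend on s alone, so that one expansion serves
  all generizations of s at once. The Jacobson radical is controlled from one side: every kernel of
  \<open>reduct s\<close> is a maximal ideal, hence residues are constant along a coset of the
  radical. Maximality rests on monomials whose valuations can be prescribed independently at all
  specializations. The division by Q makes sense only where Q has no zero, and the quotient has to
  be continued by 0. Gluing at the border asks for positive valuation, and the high power of P beats
  the finitely many orders of vanishing of Q. The number of specializations of a point acts as a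
  height; it fixes the order in which points are treated and what "as generic as possible" means.
  For a map of spaces, surjectivity makes taking preimages injective on open sets, so renaming the
  indeterminates keeps denominators nonzero.\<close>

lemma poly_mapping_eq_sum_single:
  "p = (\<Sum>k\<in>Poly_Mapping.keys p. Poly_Mapping.single k (Poly_Mapping.lookup p k))"
  by (rule poly_mapping_eqI) (simp add: lookup_sum lookup_single when_def in_keys_iff)

lemma single_add_eq_mult:
  "Poly_Mapping.single (m + n) (1 :: 'k::comm_semiring_1)
     = Poly_Mapping.single m 1 * Poly_Mapping.single (n :: 'm::comm_monoid_add) 1"
  by (simp add: mult_single)

lemma single_sum_eq_prod:
  "finite A \<Longrightarrow> Poly_Mapping.single (\<Sum>v\<in>A. f v) (1 :: 'k::comm_semiring_1)
     = (\<Prod>v\<in>A. Poly_Mapping.single (f v :: 'm::comm_monoid_add) 1)"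
  by (induction A rule: finite_induct) (simp_all add: single_add_eq_mult)

lemma single_single_eq_power:
  "Poly_Mapping.single (Poly_Mapping.single v n) (1 :: 'k::comm_semiring_1)
     = Poly_Mapping.single (Poly_Mapping.single v (1::nat)) 1 ^ n"
proof (induction n)
  case (Suc n)
  have "Poly_Mapping.single v (Suc n) = Poly_Mapping.single v 1 + Poly_Mapping.single v n"
    by (simp flip: single_add)
  then show ?case
    using Suc by (simp only: single_add_eq_mult power_Suc)
qed simp

text \<open>Given by generation, so that identities between homomorphisms follow by induction from
  constants and indeterminates. \<open>N = UNIV\<close> yields an induction rule for all
  polynomials; a smaller \<open>N\<close> confines the injectivity asked of a renaming.\<close>

inductive_set mpolys :: "'v set \<Rightarrow> ('v, 'k::field) mpoly set" for N where
  const: "mpoly_const c \<in> mpolys N"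
| var: "v \<in> N \<Longrightarrow> mpoly_var v \<in> mpolys N"
| add: "p \<in> mpolys N \<Longrightarrow> q \<in> mpolys N \<Longrightarrow> p + q \<in> mpolys N"
| mult: "p \<in> mpolys N \<Longrightarrow> q \<in> mpolys N \<Longrightarrow> p * q \<in> mpolys N"

lemma mpoly_const_hom:
  "mpoly_const 0 = 0" "mpoly_const 1 = 1"
  "mpoly_const (a + b) = mpoly_const a + mpoly_const b"
  "mpoly_const (a * b) = mpoly_const a * mpoly_const b"
  by (transfer; simp add: single_add mult_single)+

text \<open>A polynomial is a sum of monomials, each a constant times a product of powers of
  indeterminates. The decomposition is made on the underlying finite maps, and
  \<open>Abs_mpoly\<close> carries each step back.\<close>

lemma mpolys_UNIV: "(p :: ('v, 'k::field) mpoly) \<in> mpolys UNIV"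
proof -
  let ?Q = "\<lambda>p :: ('v \<Rightarrow>\<^sub>0 nat) \<Rightarrow>\<^sub>0 'k. Abs_mpoly p \<in> mpolys UNIV"
  have Abs: "Abs_mpoly (p + q) = Abs_mpoly p + Abs_mpoly q"
    "Abs_mpoly (p * q) = Abs_mpoly p * Abs_mpoly q" for p q :: "('v \<Rightarrow>\<^sub>0 nat) \<Rightarrow>\<^sub>0 'k"
    by (simp_all add: plus_mpoly.abs_eq times_mpoly.abs_eq eq_onp_same_args)
  have 0: "?Q 0" and 1: "?Q 1"
    using mpolys.const[of 0 UNIV] mpolys.const[of 1 UNIV]
    by (simp_all add: mpoly_const_hom zero_mpoly_def one_mpoly_def)
  have sum: "?Q (sum f A)" if "\<And>a. a \<in> A \<Longrightarrow> ?Q (f a)" for f :: "'c \<Rightarrow> _" and A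
    using that by (induction A rule: infinite_finite_induct) (auto simp: 0 Abs intro: mpolys.add)
  have prod: "?Q (prod f A)" if "\<And>a. a \<in> A \<Longrightarrow> ?Q (f a)" for f :: "'c \<Rightarrow> _" and A
    using that by (induction A rule: infinite_finite_induct) (auto simp: 1 Abs intro: mpolys.mult)
  have power: "?Q (q ^ n)" if "?Q q" for q n
    using that by (induction n) (auto simp: 1 Abs intro: mpolys.mult)
  have var: "?Q (Poly_Mapping.single (Poly_Mapping.single v 1) 1)" for v
    using mpolys.var[of v UNIV] by (simp add: mpoly_var_def del: One_nat_def)
  have single: "?Q (Poly_Mapping.single m c)" for m c
  proof -
    have "?Q (Poly_Mapping.single m 1)"
      by (subst poly_mapping_eq_sum_single[of m], subst single_sum_eq_prod)
        (auto intro!: prod power var[unfolded One_nat_def] simp: single_single_eq_power[of _ "Poly_Mapping.lookup m _"])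
    then have "?Q (Poly_Mapping.single 0 c * Poly_Mapping.single m 1)"
      unfolding Abs using mpolys.const[of c UNIV] by (intro mpolys.mult) (simp_all add: mpoly_const_def)
    then show ?thesis
      by (simp add: mult_single)
  qed
  have "?Q (Rep_mpoly p)"
    by (subst poly_mapping_eq_sum_single) (intro sum single)
  then show ?thesis
    by (simp add: Rep_mpoly_inverse)
qed

section \<open>Evaluation homomorphisms of polynomials\<close>

definition mono_eval :: "('v \<Rightarrow> 'r::comm_ring_1) \<Rightarrow> ('v \<Rightarrow>\<^sub>0 nat) \<Rightarrow> 'r" where
  "mono_eval g m = (\<Prod>v\<in>Poly_Mapping.keys m. g v ^ Poly_Mapping.lookup m v)"

definition mpoly_eval :: "('k::field \<Rightarrow> 'r::comm_ring_1) \<Rightarrow> ('v \<Rightarrow> 'r) \<Rightarrow> ('v, 'k) mpoly \<Rightarrow> 'r" where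
  "mpoly_eval c g p = (\<Sum>m\<in>Poly_Mapping.keys (Rep_mpoly p).
     c (Poly_Mapping.lookup (Rep_mpoly p) m) * mono_eval g m)"

lemma mono_eval_superset:
  assumes "finite A" "Poly_Mapping.keys m \<subseteq> A"
  shows "mono_eval g m = (\<Prod>v\<in>A. g v ^ Poly_Mapping.lookup m v)"
  unfolding mono_eval_def using assms by (intro prod.mono_neutral_left) (auto simp: in_keys_iff)

lemma mono_eval_add: "mono_eval g (m + n) = mono_eval g m * mono_eval g n"
proof -
  let ?A = "Poly_Mapping.keys m \<union> Poly_Mapping.keys n"
  have "Poly_Mapping.keys (m + n) \<subseteq> ?A"
    by (rule Poly_Mapping.keys_add)
  then show ?thesis
    by (simp add: mono_eval_superset[of ?A] lookup_add power_add prod.distrib)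
qed

locale coeff_hom =
  fixes c :: "'k::field \<Rightarrow> 'r::comm_ring_1"
  assumes c_one: "c 1 = 1"
    and c_add: "c (a + b) = c a + c b"
    and c_mult: "c (a * b) = c a * c b"
begin

lemma c_zero: "c 0 = 0"
  using c_add[of 0 0] by (metis add.right_neutral add_left_cancel)

abbreviation pm_eval :: "('v \<Rightarrow> 'r) \<Rightarrow> (('v \<Rightarrow>\<^sub>0 nat) \<Rightarrow>\<^sub>0 'k) \<Rightarrow> 'r" where
  "pm_eval g p \<equiv> (\<Sum>m\<in>Poly_Mapping.keys p. c (Poly_Mapping.lookup p m) * mono_eval g m)"

text \<open>Coefficients may cancel, so \<open>p\<close>, \<open>q\<close> and \<open>p + q\<close>
  have different supports; summing over one larger finite set makes them comparable.\<close>

lemma pm_eval_superset: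
  assumes "finite A" "Poly_Mapping.keys p \<subseteq> A"
  shows "pm_eval g p = (\<Sum>m\<in>A. c (Poly_Mapping.lookup p m) * mono_eval g m)"
  using assms by (intro sum.mono_neutral_left) (auto simp: in_keys_iff c_zero)

lemma pm_eval_single: "pm_eval g (Poly_Mapping.single m a) = c a * mono_eval g m"
  by (simp add: c_zero)

lemma pm_eval_add: "pm_eval g (p + q) = pm_eval g p + pm_eval g q"
proof -
  let ?A = "Poly_Mapping.keys p \<union> Poly_Mapping.keys q"
  have sub: "Poly_Mapping.keys (p + q) \<subseteq> ?A" "Poly_Mapping.keys p \<subseteq> ?A" "Poly_Mapping.keys q \<subseteq> ?A"
    by (simp_all add: Poly_Mapping.keys_add)
  have "finite ?A"
    by simp
  show ?thesis
    unfolding sub[THEN pm_eval_superset[OF \<open>finite ?A\<close>]]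
    unfolding lookup_add c_add distrib_right sum.distrib ..
qed

lemma pm_eval_sum: "pm_eval g (sum f A) = (\<Sum>a\<in>A. pm_eval g (f a))"
proof (induction A rule: infinite_finite_induct)
  case (insert x A)
  then show ?case
    by (simp only: sum.insert[OF insert.hyps] pm_eval_add)
qed simp_all

text \<open>Expanding both factors into single terms reduces the claim to the multiplicativity of
  \<open>c\<close> and \<open>mono_eval\<close>; the support of the product never has to be
  described.\<close>

lemma pm_eval_mult: "pm_eval g (p * q) = pm_eval g p * pm_eval g q"
proof -
  let ?s = "\<lambda>p k. Poly_Mapping.single k (Poly_Mapping.lookup p k)"
  have "p * q = (\<Sum>k\<in>Poly_Mapping.keys p. \<Sum>l\<in>Poly_Mapping.keys q. ?s p k * ?s q l)"
    unfolding sum_product[symmetric] by (simp flip: poly_mapping_eq_sum_single)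
  also have "pm_eval g \<dots> = (\<Sum>k\<in>Poly_Mapping.keys p. \<Sum>l\<in>Poly_Mapping.keys q.
      (c (Poly_Mapping.lookup p k) * mono_eval g k) * (c (Poly_Mapping.lookup q l) * mono_eval g l))"
    unfolding pm_eval_sum mult_single pm_eval_single
    by (simp add: mono_eval_add c_mult algebra_simps)
  finally show ?thesis
    by (simp flip: sum_product)
qed

lemma mpoly_eval_add: "mpoly_eval c g (p + q) = mpoly_eval c g p + mpoly_eval c g q"
  unfolding mpoly_eval_def plus_mpoly.rep_eq by (rule pm_eval_add)

lemma mpoly_eval_mult: "mpoly_eval c g (p * q) = mpoly_eval c g p * mpoly_eval c g q"
  unfolding mpoly_eval_def times_mpoly.rep_eq by (rule pm_eval_mult)

lemma mpoly_eval_const: "mpoly_eval c g (mpoly_const a) = c a"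
  unfolding mpoly_eval_def mpoly_const.rep_eq pm_eval_single by (simp add: mono_eval_def)

lemma mpoly_eval_var: "mpoly_eval c g (mpoly_var v) = g v"
  unfolding mpoly_eval_def mpoly_var.rep_eq pm_eval_single by (simp add: mono_eval_def c_one)

lemma mpoly_eval_one: "mpoly_eval c g 1 = 1"
  using mpoly_eval_const[of g 1] by (simp add: mpoly_const_hom c_one)

end

text \<open>
  Meaningful only on those fractions that have a denominator outside the kernel.
\<close>

definition frac_ext :: "('r::idom \<Rightarrow> 'f::field) \<Rightarrow> 'r fract \<Rightarrow> 'f" where
  "frac_ext h P = (THE e. \<exists>a b. h b \<noteq> 0 \<and> P = Fract a b \<and> e = h a / h b)"

locale idom_hom =
  fixes h :: "'r::idom \<Rightarrow> 'f::field"
  assumes h_one: "h 1 = 1"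
    and h_add: "h (a + b) = h a + h b"
    and h_mult: "h (a * b) = h a * h b"
begin

lemma h_zero: "h 0 = 0"
  using h_add[of 0 0] by (metis add.right_neutral add_left_cancel)

lemma frac_ext_Fract:
  assumes "h b \<noteq> 0"
  shows "frac_ext h (Fract a b) = h a / h b"
  unfolding frac_ext_def
proof (rule the_equality)
  fix e
  assume "\<exists>a' b'. h b' \<noteq> 0 \<and> Fract a b = Fract a' b' \<and> e = h a' / h b'"
  then obtain a' b' where b': "h b' \<noteq> 0" "Fract a b = Fract a' b'" "e = h a' / h b'"
    by blast
  moreover have "b \<noteq> 0" "b' \<noteq> 0"
    using assms b'(1) h_zero by auto
  ultimately have "a * b' = a' * b"
    by (simp add: eq_fract)
  then have "h a * h b' = h a' * h b"
    by (metis h_mult)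
  then show "e = h a / h b"
    using b' assms by (simp add: frac_eq_eq)
qed (use assms in blast)

text \<open>The localization of the domain at the kernel of \<open>h\<close>, inside its fraction
  field.\<close>

definition regular :: "'r fract set" where
  "regular = {Fract a b | a b. h b \<noteq> 0}"

lemma regularI: "h b \<noteq> 0 \<Longrightarrow> Fract a b \<in> regular"
  unfolding regular_def by blast

lemma regularE:
  assumes "P \<in> regular"
  obtains a b where "P = Fract a b" "h b \<noteq> 0" "b \<noteq> 0"
  using assms h_zero unfolding regular_def by blast

lemma frac_ext_add:
  assumes "P \<in> regular" "Q \<in> regular"
  shows "frac_ext h (P + Q) = frac_ext h P + frac_ext h Q"
  using assms
  by (elim regularE) (simp add: frac_ext_Fract h_add h_mult add_frac_eq)

lemma frac_ext_mult:
  assumes "P \<in> regular" "Q \<in> regular"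
  shows "frac_ext h (P * Q) = frac_ext h P * frac_ext h Q"
  using assms by (elim regularE) (simp add: frac_ext_Fract h_mult)

lemma frac_ext_one: "frac_ext h 1 = 1"
  using frac_ext_Fract[of 1 1] by (simp add: h_one One_fract_def)

end

section \<open>The valuation at a point\<close>

lemma coeff_hom_const: "coeff_hom const"
  by unfold_locales (simp_all add: const_def mpoly_const_hom One_fract_def)

lemma coeff_hom_pconst: "coeff_hom (\<lambda>a. [:const a:])"
  by unfold_locales
    (simp_all add: coeff_hom.c_one[OF coeff_hom_const] coeff_hom.c_add[OF coeff_hom_const]
      coeff_hom.c_mult[OF coeff_hom_const] one_pCons)

text \<open>
  The substitution of \<open>T\<^sub>U z\<close> for those \<open>T\<^sub>U\<close> with \<open>s \<notin> U\<close>, as a homomorphism into Laurent series in \<open>z\<close>.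
  The order at \<open>z = 0\<close> is the valuation of \<open>dvr \<X> x s\<close>, for all \<open>x\<close> at once, and the constant
  coefficient is the residue.
\<close>

definition pexpand :: "'a \<Rightarrow> ('a set, 'k::field) mpoly \<Rightarrow> ('a set, 'k) ratfun poly" where
  "pexpand s = mpoly_eval (\<lambda>a. [:const a:]) (\<lambda>U. if s \<in> U then [:indet U:] else [:0, indet U:])"

definition lexpand :: "'a \<Rightarrow> ('a set, 'k::field) mpoly \<Rightarrow> ('a set, 'k) ratfun fls" where
  "lexpand s p = fps_to_fls (fps_of_poly (pexpand s p))"

definition expand :: "'a \<Rightarrow> ('a set, 'k::field) ratfun \<Rightarrow> ('a set, 'k) ratfun fls" where
  "expand s = frac_ext (lexpand s)"

lemma pexpand_simps:
  "pexpand s (p + q) = pexpand s p + pexpand s q"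
  "pexpand s (p * q) = pexpand s p * pexpand s q"
  "pexpand s 1 = 1"
  "pexpand s (mpoly_const a) = [:const a:]"
  "pexpand s (mpoly_var U) = (if s \<in> U then [:indet U:] else [:0, indet U:])"
  unfolding pexpand_def
  by (rule coeff_hom.mpoly_eval_add coeff_hom.mpoly_eval_mult coeff_hom.mpoly_eval_one
      coeff_hom.mpoly_eval_const coeff_hom.mpoly_eval_var, rule coeff_hom_pconst)+

text \<open>Setting z = 1 undoes the substitution, which makes \<open>pexpand s\<close>
  injective.\<close>

lemma poly_pexpand: "poly (pexpand s p) 1 = Fract p 1"
  using mpolys_UNIV[of p]
proof induction
  case (const c)
  then show ?case
    by (simp add: pexpand_simps const_def)
next
  case (var U)
  then show ?case
    by (simp add: pexpand_simps indet_def)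
qed (simp_all add: pexpand_simps)

interpretation lexpand: idom_hom "lexpand s" for s
  by unfold_locales
    (simp_all add: lexpand_def pexpand_simps fps_of_poly_add fps_of_poly_mult fls_times_fps_to_fls)

lemma lexpand_eq_0_iff [simp]: "lexpand s p = 0 \<longleftrightarrow> p = 0"
proof
  assume "lexpand s p = 0"
  then have "pexpand s p = 0"
    using fps_of_poly_eq_iff[of "pexpand s p" 0] by (simp add: lexpand_def)
  then show "p = 0"
    using poly_pexpand[of s p] by (simp add: Zero_fract_def eq_fract)
qed (simp add: lexpand.h_zero)

text \<open>Injectivity of \<open>lexpand s\<close> keeps all denominators out of its kernel, so
  \<open>expand s\<close> is a homomorphism on the whole field.\<close>

lemma lexpand_regular [simp]: "P \<in> lexpand.regular s"
  by (cases P) (auto intro: lexpand.regularI)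

lemma expand_add [simp]: "expand s (P + Q) = expand s P + expand s Q"
  unfolding expand_def by (rule lexpand.frac_ext_add) simp_all

lemma expand_mult [simp]: "expand s (P * Q) = expand s P * expand s Q"
  unfolding expand_def by (rule lexpand.frac_ext_mult) simp_all

lemma expand_one [simp]: "expand s 1 = 1"
  unfolding expand_def by (rule lexpand.frac_ext_one)

lemma expand_zero [simp]: "expand s 0 = 0"
  using expand_add[of s 0 0] by (metis add.right_neutral add_left_cancel)

lemma expand_uminus [simp]: "expand s (- P) = - expand s P"
  using expand_add[of s P "- P"] by (simp add: eq_neg_iff_add_eq_0 add.commute)

lemma expand_diff [simp]: "expand s (P - Q) = expand s P - expand s Q"
  using expand_add[of s P "- Q"] by simp

lemma expand_eq_0_iff [simp]: "expand s P = 0 \<longleftrightarrow> P = 0"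
proof
  assume "expand s P = 0"
  then show "P = 0"
    using expand_mult[of s P "inverse P"] by (cases "P = 0") auto
qed simp

lemma expand_inverse [simp]: "expand s (inverse P) = inverse (expand s P)"
proof (cases "P = 0")
  case False
  then have "expand s P * expand s (inverse P) = 1"
    by (simp flip: expand_mult)
  then show ?thesis
    by (simp add: inverse_unique)
qed simp

lemma expand_power [simp]: "expand s (P ^ n) = expand s P ^ n"
  by (induction n) simp_all

lemma expand_Fract_1: "expand s (Fract p 1) = lexpand s p"
  by (simp add: expand_def lexpand.frac_ext_Fract lexpand.h_one)

lemma expand_const [simp]: "expand s (const a) = fls_const (const a)"
  unfolding const_def[of a] expand_Fract_1 unfolding lexpand_def pexpand_simps
  by (simp add: fps_of_poly_const const_def)

lemma expand_indet:
  "expand s (indet U :: ('a set, 'k::field) ratfun)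
     = (if s \<in> U then fls_const (indet U) else fls_const (indet U) * fls_X)"
proof -
  let ?T = "indet U :: ('a set, 'k) ratfun"
  have "[:0, ?T:] = [:?T:] * [:0, 1:]"
    by simp
  then have "fps_to_fls (fps_of_poly [:0, ?T:]) = fls_const ?T * fls_X"
    by (simp only: fps_of_poly_mult fls_times_fps_to_fls fps_of_poly_const fps_of_poly_fps_X) simp
  moreover have "expand s ?T = lexpand s (mpoly_var U)"
    by (simp add: indet_def expand_Fract_1)
  ultimately show ?thesis
    by (simp add: lexpand_def pexpand_simps fps_of_poly_const)
qed

text \<open>The zero series has subdegree 0, so \<open>0 \<le> val s P\<close> includes
  \<open>P = 0\<close> and says exactly that the expansion has no pole. Zero is a separate case
  wherever positive valuation is meant.\<close>

definition val :: "'a \<Rightarrow> ('a set, 'k::field) ratfun \<Rightarrow> int" where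
  "val s P = fls_subdegree (expand s P)"

text \<open>Defined and additive for all \<open>P\<close>, but a residue only for integral
  \<open>P\<close>.\<close>

definition reduct :: "'a \<Rightarrow> ('a set, 'k::field) ratfun \<Rightarrow> ('a set, 'k) ratfun" where
  "reduct s P = fls_nth (expand s P) 0"

lemma val_mult: "P \<noteq> 0 \<Longrightarrow> Q \<noteq> 0 \<Longrightarrow> val s (P * Q) = val s P + val s Q"
  by (simp add: val_def)

lemma val_inverse [simp]: "val s (inverse P) = - val s P"
  by (simp add: val_def)

lemma val_divide: "P \<noteq> 0 \<Longrightarrow> Q \<noteq> 0 \<Longrightarrow> val s (P / Q) = val s P - val s Q"
  by (simp add: divide_inverse val_mult)

lemma val_0 [simp]: "val s 0 = 0"
  by (simp add: val_def)

lemma val_1 [simp]: "val s 1 = 0"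
  by (simp add: val_def)

lemma val_power [simp]: "val s (P ^ n) = int n * val s P"
  by (simp add: val_def fls_subdegree_pow)

lemma indet_nonzero [simp]: "indet U \<noteq> 0"
proof -
  have "mpoly_var U \<noteq> 0"
    by transfer (metis keys_eq_empty keys_single insert_not_empty zero_neq_one)
  then show ?thesis
    by (simp add: indet_def Zero_fract_def eq_fract)
qed

lemma val_indet: "val s (indet U) = (if s \<in> U then 0 else 1)"
  by (simp add: val_def expand_indet)

lemma integral_add: "0 \<le> val s P \<Longrightarrow> 0 \<le> val s Q \<Longrightarrow> 0 \<le> val s (P + Q)"
  unfolding val_def expand_add by (rule fls_subdegree_ge0I) simp

lemma integral_mult: "0 \<le> val s P \<Longrightarrow> 0 \<le> val s Q \<Longrightarrow> 0 \<le> val s (P * Q)"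
  unfolding val_def expand_mult by (rule fls_mult_subdegree_ge_0)

lemma val_uminus [simp]: "val s (- P) = val s P"
  by (simp add: val_def)

lemma integral_diff: "0 \<le> val s P \<Longrightarrow> 0 \<le> val s Q \<Longrightarrow> 0 \<le> val s (P - Q)"
  using integral_add[of s P "- Q"] by simp

lemma reduct_add [simp]: "reduct s (P + Q) = reduct s P + reduct s Q"
  by (simp add: reduct_def)

lemma reduct_diff [simp]: "reduct s (P - Q) = reduct s P - reduct s Q"
  by (simp add: reduct_def)

lemma reduct_uminus [simp]: "reduct s (- P) = - reduct s P"
  by (simp add: reduct_def)

lemma reduct_0 [simp]: "reduct s 0 = 0"
  by (simp add: reduct_def)

lemma reduct_1 [simp]: "reduct s 1 = 1"
  by (simp add: reduct_def)

text \<open>Integral elements expand into power series, whose constant coefficients multiply; with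
  poles, other pairs of coefficients would contribute.\<close>

lemma reduct_mult:
  assumes "0 \<le> val s P" "0 \<le> val s Q"
  shows "reduct s (P * Q) = reduct s P * reduct s Q"
proof -
  have "fps_to_fls (fls_regpart (expand s P)) = expand s P"
    "fps_to_fls (fls_regpart (expand s Q)) = expand s Q"
    using assms by (simp_all add: val_def)
  then have "expand s P * expand s Q
      = fps_to_fls (fls_regpart (expand s P) * fls_regpart (expand s Q))"
    by (simp add: fls_times_fps_to_fls)
  then show ?thesis
    by (simp add: reduct_def)
qed

lemma reduct_eq_0_iff:
  assumes "0 \<le> val s P"
  shows "reduct s P = 0 \<longleftrightarrow> P = 0 \<or> 0 < val s P"
proof (cases "P = 0")
  case False
  show ?thesis
  proof (cases "val s P = 0")
    case True
    then have "reduct s P \<noteq> 0"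
      using False nth_fls_subdegree_nonzero[of "expand s P"] by (simp add: reduct_def val_def)
    then show ?thesis
      using False True by simp
  next
    case F: False
    then show ?thesis
      using assms by (simp add: reduct_def val_def)
  qed
qed simp

lemma integral_inverse:
  assumes "0 \<le> val s P" "reduct s P \<noteq> 0"
  shows "0 \<le> val s (inverse P)" "reduct s (inverse P) = inverse (reduct s P)"
proof -
  have "val s P = 0" "P \<noteq> 0"
    using assms reduct_eq_0_iff[OF assms(1)] by auto
  then show *: "0 \<le> val s (inverse P)"
    by simp
  have "reduct s P * reduct s (inverse P) = 1"
    using reduct_mult[OF assms(1) *] \<open>P \<noteq> 0\<close> by simp
  then show "reduct s (inverse P) = inverse (reduct s P)"
    by (simp add: inverse_unique)
qed

lemma integral_divide:
  assumes "0 \<le> val s P" "0 \<le> val s Q" "reduct s Q \<noteq> 0"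
  shows "0 \<le> val s (P / Q)" "reduct s (P / Q) = reduct s P / reduct s Q"
  using assms integral_inverse[OF assms(2,3)]
  by (simp_all add: divide_inverse integral_mult reduct_mult)

section \<open>Generated subfields\<close>

lemma ratfun_ring_simps [simp]:
  "carrier ratfun_ring = UNIV" "mult ratfun_ring P Q = P * Q" "one ratfun_ring = 1"
  "zero ratfun_ring = 0" "add ratfun_ring P Q = P + Q"
  by (simp_all add: ring_of_type_algebra_def)

lemma ratfun_ring_m_inv [simp]: "P \<noteq> 0 \<Longrightarrow> inv\<^bsub>ratfun_ring\<^esub> P = inverse P"
  by (rule comm_monoid.comm_inv_char[OF cring.axioms(2)[OF cring_from_type_algebra]]) simp_all

lemma ratfun_ring_a_inv [simp]: "\<ominus>\<^bsub>ratfun_ring\<^esub> P = - P"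
  by (rule abelian_group.minus_equality[OF ring.is_abelian_group[OF ring_from_type_algebra]])
    simp_all

lemma adjoin_1: "1 \<in> adjoin S"
  unfolding adjoin_def using generate_field.one[of ratfun_ring] by simp

lemma adjoin_const: "const c \<in> adjoin S"
  unfolding adjoin_def by (rule generate_field.incl) simp

lemma adjoin_incl: "P \<in> S \<Longrightarrow> P \<in> adjoin S"
  unfolding adjoin_def by (rule generate_field.incl) simp

lemma adjoin_add: "P \<in> adjoin S \<Longrightarrow> Q \<in> adjoin S \<Longrightarrow> P + Q \<in> adjoin S"
  unfolding adjoin_def using generate_field.eng_add[of _ ratfun_ring] by simp

lemma adjoin_mult: "P \<in> adjoin S \<Longrightarrow> Q \<in> adjoin S \<Longrightarrow> P * Q \<in> adjoin S"
  unfolding adjoin_def using generate_field.eng_mult[of _ ratfun_ring] by simp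

lemma adjoin_uminus: "P \<in> adjoin S \<Longrightarrow> - P \<in> adjoin S"
  unfolding adjoin_def using generate_field.a_inv[of _ ratfun_ring] by simp

lemma adjoin_0: "0 \<in> adjoin S"
  using adjoin_add[OF adjoin_1 adjoin_uminus[OF adjoin_1]] by simp

lemma adjoin_diff: "P \<in> adjoin S \<Longrightarrow> Q \<in> adjoin S \<Longrightarrow> P - Q \<in> adjoin S"
  using adjoin_add[of P S "- Q"] adjoin_uminus[of Q S] by simp

lemma adjoin_inverse: "P \<in> adjoin S \<Longrightarrow> inverse P \<in> adjoin S"
  using generate_field.m_inv[of P ratfun_ring "range const \<union> S"]
  by (cases "P = 0") (simp_all add: adjoin_0 adjoin_def[symmetric])

lemma adjoin_divide: "P \<in> adjoin S \<Longrightarrow> Q \<in> adjoin S \<Longrightarrow> P / Q \<in> adjoin S"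
  by (simp add: divide_inverse adjoin_mult adjoin_inverse)

lemma adjoin_power: "P \<in> adjoin S \<Longrightarrow> P ^ n \<in> adjoin S"
  by (induction n) (simp_all add: adjoin_1 adjoin_mult)

lemmas adjoin_closed = adjoin_0 adjoin_1 adjoin_const adjoin_add adjoin_mult adjoin_uminus adjoin_diff
  adjoin_inverse adjoin_divide adjoin_power

lemma const_1: "const 1 = 1"
  by (rule coeff_hom.c_one[OF coeff_hom_const])

lemma const_0: "const 0 = 0"
  by (rule coeff_hom.c_zero[OF coeff_hom_const])

lemma const_uminus: "const (- a) = - const a"
  using const_0 coeff_hom.c_add[OF coeff_hom_const] by (metis add_eq_0_iff2 left_minus)

text \<open>\<open>- P\<close> is \<open>const (- 1) * P\<close>, so the negation step of
  \<open>generate_field\<close> is absorbed by the cases \<open>const\<close> and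
  \<open>mult\<close>.\<close>

lemma adjoin_induct [consumes 1, case_names const incl add mult inverse]:
  assumes "P \<in> adjoin S"
    and const: "\<And>c. Q (const c)"
    and incl: "\<And>P. P \<in> S \<Longrightarrow> Q P"
    and add: "\<And>P P'. P \<in> adjoin S \<Longrightarrow> P' \<in> adjoin S \<Longrightarrow> Q P \<Longrightarrow> Q P' \<Longrightarrow> Q (P + P')"
    and mult: "\<And>P P'. P \<in> adjoin S \<Longrightarrow> P' \<in> adjoin S \<Longrightarrow> Q P \<Longrightarrow> Q P' \<Longrightarrow> Q (P * P')"
    and inverse: "\<And>P. P \<in> adjoin S \<Longrightarrow> P \<noteq> 0 \<Longrightarrow> Q P \<Longrightarrow> Q (inverse P)"
  shows "Q P"
  using assms(1) unfolding adjoin_def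
proof (induction rule: generate_field.induct)
  case one
  then show ?case
    using const[of 1] by (simp add: const_1)
next
  case (incl h)
  then show ?case
    using const assms(3) by auto
next
  case (a_inv h)
  then have "Q (const (- 1) * h)"
    by (intro mult const adjoin_const) (simp_all add: adjoin_def)
  then show ?case
    by (simp add: const_uminus const_1)
qed (use add mult inverse in \<open>simp_all add: adjoin_def\<close>)

lemma adjoin_mono:
  assumes "S \<subseteq> adjoin T"
  shows "adjoin S \<subseteq> adjoin T"
proof
  fix P
  assume "P \<in> adjoin S"
  then show "P \<in> adjoin T"
    by (induction rule: adjoin_induct) (use assms in \<open>auto intro: adjoin_closed\<close>)
qed

lemmas point_field_closed [intro] = adjoin_closed[where S = "{indet U | U. openin \<X> U \<and> x \<in> U}" for \<X> x,
    folded point_field_def]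

lemma indet_in_point_field: "openin \<X> U \<Longrightarrow> x \<in> U \<Longrightarrow> indet U \<in> point_field \<X> x"
  unfolding point_field_def by (rule adjoin_incl) blast

section \<open>Finite Kolmogoroff spaces\<close>

lemma specializations_iff:
  "s \<in> specializations \<X> x \<longleftrightarrow> s \<in> topspace \<X> \<and> x \<in> topspace \<X> \<and> s \<noteq> x \<and>
     (\<forall>U. openin \<X> U \<and> s \<in> U \<longrightarrow> x \<in> U)"
  unfolding specializations_def
  by (auto simp: in_closure_of dest: openin_subset)

locale kolmogoroff =
  fixes \<X> :: "'a topology"
  assumes fin: "finite_kolmogoroff \<X>"
begin

lemma finite_topspace: "finite (topspace \<X>)" and t0: "t0_space \<X>"
  using fin unfolding finite_kolmogoroff_def by blast+

lemma finite_specializations: "finite (specializations \<X> x)"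
  by (rule finite_subset[OF _ finite_topspace]) (auto simp: specializations_iff)

lemma separating_open:
  assumes "s \<in> specializations \<X> x"
  shows "\<exists>U. openin \<X> U \<and> x \<in> U \<and> s \<notin> U"
  using assms t0 unfolding specializations_iff t0_space_def by metis

lemma specializations_trans:
  assumes "s \<in> specializations \<X> y" "y \<in> specializations \<X> x"
  shows "s \<in> specializations \<X> x"
proof -
  \<comment> \<open>This is where T0 enters: an open set around \<open>y\<close> that misses
    \<open>s\<close> must contain \<open>x\<close>.\<close>
  have "s \<noteq> x"
    using assms separating_open[OF assms(1)] by (metis specializations_iff)
  then show ?thesis
    using assms unfolding specializations_iff by blast
qed

text \<open>Finiteness gives every point a smallest neighbourhood, which consists of the point and
  its generizations. So openness can be tested on generizations alone.\<close>

lemma openin_generalizing: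
  assumes "U \<subseteq> topspace \<X>"
    and "\<And>x s. s \<in> U \<Longrightarrow> s \<in> specializations \<X> x \<Longrightarrow> x \<in> U"
  shows "openin \<X> U"
proof (subst openin_subopen, intro ballI)
  fix s
  assume s: "s \<in> U"
  then have sX: "s \<in> topspace \<X>"
    using assms(1) by blast
  \<comment> \<open>\<open>V y\<close> excludes \<open>y\<close> whenever some neighbourhood of
    \<open>s\<close> does, and is the whole space otherwise; the finite intersection over all
    \<open>y\<close> is the smallest neighbourhood of \<open>s\<close>.\<close>
  define V where "V y = (if \<exists>W. openin \<X> W \<and> s \<in> W \<and> y \<notin> W
    then SOME W. openin \<X> W \<and> s \<in> W \<and> y \<notin> W else topspace \<X>)" for y
  have V: "openin \<X> (V y)" "s \<in> V y" for y
    using someI_ex[of "\<lambda>W. openin \<X> W \<and> s \<in> W \<and> y \<notin> W"] sX by (auto simp: V_def)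
  have Vn: "y \<notin> V y" if "openin \<X> W" "s \<in> W" "y \<notin> W" for y W
    using someI[of "\<lambda>W. openin \<X> W \<and> s \<in> W \<and> y \<notin> W" W] that by (auto simp: V_def)
  let ?W = "\<Inter>y\<in>topspace \<X>. V y"
  have "y \<in> U" if "y \<in> ?W" for y
  proof -
    have y: "y \<in> topspace \<X>"
      using V(1)[of s] openin_subset that sX by blast
    then have "y \<in> W" if "openin \<X> W" "s \<in> W" for W
      using Vn[OF that] \<open>y \<in> ?W\<close> by blast
    then show ?thesis
      using assms(2)[of s y] s sX y by (cases "y = s") (auto simp: specializations_iff)
  qed
  moreover have "openin \<X> ?W"
    by (rule openin_INT2) (use finite_topspace sX V in auto)
  moreover have "s \<in> ?W"
    using V by blast
  ultimately show "\<exists>T. openin \<X> T \<and> s \<in> T \<and> T \<subseteq> U"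
    by blast
qed

section \<open>The discrete valuation rings\<close>

context
  fixes x s :: 'a
  assumes s: "s \<in> specializations \<X> x"
begin

abbreviation sep :: "'a set" where
  "sep \<equiv> SOME U. openin \<X> U \<and> x \<in> U \<and> s \<notin> U"

lemma sep: "openin \<X> sep" "x \<in> sep" "s \<notin> sep"
  using someI_ex[OF separating_open[OF s]] by blast+

lemma unif_nonzero: "unif \<X> x s \<noteq> 0"
  by (simp add: unif_def)

lemma val_unif: "val s (unif \<X> x s) = 1"
  by (simp add: unif_def val_indet sep)

lemma unif_in_point_field: "unif \<X> x s \<in> point_field \<X> x"
  by (simp add: unif_def indet_in_point_field sep)

lemma res_field_subset: "res_field \<X> x s \<subseteq> point_field \<X> x"
  unfolding res_field_def point_field_def
proof (rule adjoin_mono, fold point_field_def)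
  have "x \<in> U" if "openin \<X> U" "s \<in> U" for U
    using s that by (simp add: specializations_iff)
  then show "{indet U |U. openin \<X> U \<and> s \<in> U} \<union>
    {indet U / indet V |U V. openin \<X> U \<and> x \<in> U \<and> s \<notin> U \<and> openin \<X> V \<and> x \<in> V \<and> s \<notin> V}
    \<subseteq> point_field \<X> x"
    by (auto intro: indet_in_point_field)
qed

lemma point_field_specialization_subset: "point_field \<X> s \<subseteq> res_field \<X> x s"
  unfolding res_field_def point_field_def by (rule adjoin_mono) (blast intro: adjoin_incl)

text \<open>In \<open>indet U / indet V\<close> with both sets missing \<open>s\<close> the factors
  z cancel, and \<open>indet U\<close> with \<open>s\<close> in \<open>U\<close> carries none. Hence
  every element of \<open>res_field\<close> is its own residue.\<close>

lemma expand_res_field: "P \<in> res_field \<X> x s \<Longrightarrow> expand s P = fls_const P"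
  unfolding res_field_def
proof (induction rule: adjoin_induct)
  case (incl P)
  then show ?case
    by (auto simp: expand_indet divide_inverse fls_inverse_const
        simp flip: fls_const_mult_const)
next
  case (add P P')
  then show ?case
    by (simp add: fls_plus_const)
qed (simp_all add: fls_inverse_const)

lemma val_res_field: "P \<in> res_field \<X> x s \<Longrightarrow> val s P = 0"
  by (simp add: val_def expand_res_field)

lemma reduct_res_field: "P \<in> res_field \<X> x s \<Longrightarrow> reduct s P = P"
  by (simp add: reduct_def expand_res_field)

section \<open>The polynomial ring over the residue field and its localization\<close>

abbreviation polys :: "('a set, 'k::field) ratfun set" where
  "polys \<equiv> carrier (res_poly_ring \<X> x s)"

lemma polys_res_field: "c \<in> res_field \<X> x s \<Longrightarrow> c \<in> polys"
  by (simp add: res_poly_ring_def generate_ring.incl)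

lemma polys_unif: "unif \<X> x s \<in> polys"
  by (simp add: res_poly_ring_def generate_ring.incl)

lemma polys_add: "a \<in> polys \<Longrightarrow> b \<in> polys \<Longrightarrow> a + b \<in> polys"
  using generate_ring.eng_add[of a ratfun_ring _ b] by (simp add: res_poly_ring_def)

lemma polys_mult: "a \<in> polys \<Longrightarrow> b \<in> polys \<Longrightarrow> a * b \<in> polys"
  using generate_ring.eng_mult[of a ratfun_ring _ b] by (simp add: res_poly_ring_def)

lemma polys_uminus: "a \<in> polys \<Longrightarrow> - a \<in> polys"
  using generate_ring.a_inv[of a ratfun_ring] by (simp add: res_poly_ring_def)

lemma polys_1: "1 \<in> polys"
  using generate_ring.one[of ratfun_ring] by (simp add: res_poly_ring_def)

lemma polys_power: "a \<in> polys \<Longrightarrow> a ^ n \<in> polys"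
  by (induction n) (simp_all add: polys_1 polys_mult)

lemmas res_field_closed = adjoin_closed[where S = "{indet U | U. openin \<X> U \<and> s \<in> U} \<union>
      {indet U / indet V | U V. openin \<X> U \<and> x \<in> U \<and> s \<notin> U \<and> openin \<X> V \<and> x \<in> V \<and> s \<notin> V}",
    folded res_field_def]

text \<open>Division with remainder by the uniformizer. Only existence is claimed; that the
  remainder is determined follows later, because \<open>reduct s\<close> returns it.\<close>

lemma polys_decompose:
  assumes "a \<in> polys"
  shows "\<exists>c\<in>res_field \<X> x s. \<exists>b\<in>polys. a = c + b * unif \<X> x s"
  using assms[unfolded res_poly_ring_def, simplified]
proof (induction rule: generate_ring.induct)
  case one
  show ?case
    by (rule bexI[of _ 1], rule bexI[of _ 0]) (auto intro: res_field_closed polys_res_field)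
next
  case (incl h)
  then show ?case
  proof
    assume "h = unif \<X> x s"
    then show ?thesis
      by (intro bexI[of _ 0] bexI[of _ 1]) (auto intro: res_field_closed polys_1)
  next
    assume "h \<in> res_field \<X> x s"
    then show ?thesis
      by (intro bexI[of _ h] bexI[of _ 0]) (auto intro: res_field_closed polys_res_field)
  qed
next
  case (a_inv h)
  then obtain c b where *: "c \<in> res_field \<X> x s" "b \<in> polys" "h = c + b * unif \<X> x s"
    by blast
  show ?case
    by (rule bexI[of _ "- c"], rule bexI[of _ "- b"])
      (use * in \<open>auto intro: res_field_closed polys_uminus\<close>)
next
  case (eng_add h1 h2)
  then obtain c1 b1 c2 b2 where *: "c1 \<in> res_field \<X> x s" "b1 \<in> polys" "h1 = c1 + b1 * unif \<X> x s"
    "c2 \<in> res_field \<X> x s" "b2 \<in> polys" "h2 = c2 + b2 * unif \<X> x s"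
    by blast
  show ?case
    by (rule bexI[of _ "c1 + c2"], rule bexI[of _ "b1 + b2"])
      (use * in \<open>auto intro: res_field_closed polys_add simp: algebra_simps\<close>)
next
  case (eng_mult h1 h2)
  then obtain c1 b1 c2 b2 where *: "c1 \<in> res_field \<X> x s" "b1 \<in> polys" "h1 = c1 + b1 * unif \<X> x s"
    "c2 \<in> res_field \<X> x s" "b2 \<in> polys" "h2 = c2 + b2 * unif \<X> x s"
    by blast
  show ?case
    by (rule bexI[of _ "c1 * c2"], rule bexI[of _ "c1 * b2 + b1 * c2 + b1 * b2 * unif \<X> x s"])
      (use * in \<open>auto intro!: res_field_closed polys_add polys_mult polys_unif
        intro: polys_res_field simp: algebra_simps\<close>)
qed

lemma reduct_unif: "reduct s (unif \<X> x s) = 0"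
  using reduct_eq_0_iff[of s "unif \<X> x s"] by (simp add: val_unif)

lemma polys_integral:
  assumes "a \<in> polys"
  shows "0 \<le> val s a" "reduct s a \<in> res_field \<X> x s" "a \<in> point_field \<X> x"
proof -
  have *: "0 \<le> val s a \<and> a \<in> point_field \<X> x" if "a \<in> polys" for a
    using that[unfolded res_poly_ring_def, simplified]
    by (induction rule: generate_ring.induct)
      (use res_field_subset in \<open>auto simp: val_res_field val_unif unif_in_point_field
        intro: integral_add integral_mult\<close>)
  from *[OF assms] show "0 \<le> val s a" "a \<in> point_field \<X> x"
    by blast+
  obtain c b where cb: "c \<in> res_field \<X> x s" "b \<in> polys" "a = c + b * unif \<X> x s"
    using polys_decompose[OF assms] by blast
  then show "reduct s a \<in> res_field \<X> x s"
    by (simp add: reduct_mult * val_unif reduct_unif reduct_res_field)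
qed

lemma polys_reduct_0:
  assumes "a \<in> polys" "reduct s a = 0"
  shows "\<exists>b\<in>polys. a = b * unif \<X> x s"
proof -
  obtain c b where cb: "c \<in> res_field \<X> x s" "b \<in> polys" "a = c + b * unif \<X> x s"
    using polys_decompose[OF assms(1)] by blast
  then have "reduct s a = c"
    by (simp add: reduct_mult[OF polys_integral(1)] val_unif reduct_unif reduct_res_field)
  then show ?thesis
    using assms(2) cb by auto
qed

lemma mem_PIdl_unif: "a \<in> polys \<Longrightarrow> a \<in> PIdl\<^bsub>res_poly_ring \<X> x s\<^esub> (unif \<X> x s) \<longleftrightarrow> reduct s a = 0"
proof -
  assume a: "a \<in> polys"
  have "PIdl\<^bsub>res_poly_ring \<X> x s\<^esub> (unif \<X> x s) = {b * unif \<X> x s | b. b \<in> polys}"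
    unfolding cgenideal_def by (simp add: res_poly_ring_def)
  then show ?thesis
    using polys_reduct_0[OF a]
    by (auto simp: reduct_mult[OF polys_integral(1)] val_unif reduct_unif)
qed

text \<open>On the polynomial ring the ideal of the uniformizer is the kernel of
  \<open>reduct s\<close>, so the admissible denominators are those with nonzero residue.\<close>

lemma carrier_dvr_eq: "carrier (dvr \<X> x s) = {a / b | a b. a \<in> polys \<and> b \<in> polys \<and> reduct s b \<noteq> 0}"
  unfolding dvr_def using mem_PIdl_unif by auto

text \<open>Each uniformizer split off lowers the valuation by 1, and at valuation 0 the residue is
  nonzero, so the process stops after \<open>val s a\<close> steps.\<close>

lemma polys_factor:
  assumes "a \<in> polys" "a \<noteq> 0"
  shows "\<exists>b\<in>polys. reduct s b \<noteq> 0 \<and> a = b * unif \<X> x s ^ nat (val s a)"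
  using assms
proof (induction "nat (val s a)" arbitrary: a)
  case 0
  then have "val s a = 0"
    using polys_integral(1)[of a] by simp
  then show ?case
    using 0 reduct_eq_0_iff[of s a] by auto
next
  case (Suc n)
  then have "reduct s a = 0"
    using polys_integral(1)[of a] reduct_eq_0_iff[of s a] by auto
  then obtain b where b: "b \<in> polys" "a = b * unif \<X> x s"
    using polys_reduct_0 Suc.prems by blast
  then have "val s a = val s b + 1"
    using Suc.prems by (simp add: val_mult val_unif unif_nonzero)
  then have n: "n = nat (val s b)" and n': "nat (val s a) = Suc n"
    using Suc.hyps(2) polys_integral(1)[OF b(1)] by auto
  have "b \<noteq> 0"
    using b Suc.prems by auto
  from Suc.hyps(1)[OF n b(1) this] obtain b' where
    "b' \<in> polys" "reduct s b' \<noteq> 0" "b = b' * unif \<X> x s ^ n"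
    unfolding n by blast
  then show ?case
    using b unfolding n' by (intro bexI[of _ b']) auto
qed

text \<open>The point field is the fraction field of \<open>polys\<close>, since each of its
  generators lies in \<open>polys\<close>.\<close>

lemma point_field_fraction:
  assumes "P \<in> point_field \<X> x"
  shows "\<exists>a\<in>polys. \<exists>b\<in>polys. b \<noteq> 0 \<and> P = a / b"
  using assms unfolding point_field_def
proof (induction rule: adjoin_induct)
  case (const c)
  show ?case
    by (intro bexI[of _ "const c"] bexI[of _ 1]) (auto intro: polys_1 polys_res_field res_field_closed)
next
  case (incl P)
  then obtain U where U: "P = indet U" "openin \<X> U" "x \<in> U"
    by blast
  have "P \<in> polys"
  proof (cases "s \<in> U")
    case True
    then show ?thesis
      using U unfolding res_field_def by (auto intro!: polys_res_field adjoin_incl simp: res_field_def)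
  next
    case False
    \<comment> \<open>When \<open>U\<close> misses \<open>s\<close>, its indeterminate is this
      element of the residue field times the uniformizer.\<close>
    have "indet U / indet sep \<in> res_field \<X> x s"
      using U sep False unfolding res_field_def by (intro adjoin_incl) blast
    then have "indet U / indet sep * unif \<X> x s \<in> polys"
      by (intro polys_mult polys_unif polys_res_field)
    then show ?thesis
      using U by (simp add: unif_def)
  qed
  then show ?case
    by (intro bexI[of _ P] bexI[of _ 1]) (auto intro: polys_1)
next
  case (add P P')
  then obtain a b a' b' where *: "a \<in> polys" "b \<in> polys" "b \<noteq> 0" "P = a / b"
    "a' \<in> polys" "b' \<in> polys" "b' \<noteq> 0" "P' = a' / b'"
    by blast
  show ?case
    by (intro bexI[of _ "a * b' + a' * b"] bexI[of _ "b * b'"])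
      (use * in \<open>auto intro: polys_add polys_mult simp: field_simps\<close>)
next
  case (mult P P')
  then obtain a b a' b' where *: "a \<in> polys" "b \<in> polys" "b \<noteq> 0" "P = a / b"
    "a' \<in> polys" "b' \<in> polys" "b' \<noteq> 0" "P' = a' / b'"
    by blast
  show ?case
    by (intro bexI[of _ "a * a'"] bexI[of _ "b * b'"])
      (use * in \<open>auto intro: polys_mult\<close>)
next
  case (inverse P)
  then obtain a b where *: "a \<in> polys" "b \<in> polys" "b \<noteq> 0" "P = a / b"
    by blast
  show ?case
    by (intro bexI[of _ b] bexI[of _ a]) (use * inverse(2) in auto)
qed

text \<open>The valuation frees the ring from the chosen uniformizer. In a fraction the powers of
  the uniformizer combine into one with exponent \<open>val s P\<close>; if this is nonnegative, the
  power can be moved to the numerator.\<close>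

lemma dvr_iff: "P \<in> carrier (dvr \<X> x s) \<longleftrightarrow> P \<in> point_field \<X> x \<and> 0 \<le> val s P"
proof
  assume "P \<in> carrier (dvr \<X> x s)"
  then show "P \<in> point_field \<X> x \<and> 0 \<le> val s P"
    unfolding carrier_dvr_eq by (auto intro: polys_integral integral_divide(1))
next
  let ?t = "unif \<X> x s"
  assume P: "P \<in> point_field \<X> x \<and> 0 \<le> val s P"
  show "P \<in> carrier (dvr \<X> x s)"
  proof (cases "P = 0")
    case True
    then have "P = 0 / 1" "0 \<in> polys"
      by (auto intro: polys_res_field res_field_closed)
    then show ?thesis
      unfolding carrier_dvr_eq using polys_1 reduct_1[of s] zero_neq_one by (metis (mono_tags, lifting) mem_Collect_eq)
  next
    case False
    obtain a b where ab: "a \<in> polys" "b \<in> polys" "b \<noteq> 0" "P = a / b"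
      using point_field_fraction P by blast
    then have "a \<noteq> 0"
      using False by auto
    obtain a' where a': "a' \<in> polys" "a = a' * ?t ^ nat (val s a)"
      using polys_factor[OF ab(1) \<open>a \<noteq> 0\<close>] by blast
    obtain b' where b': "b' \<in> polys" "reduct s b' \<noteq> 0" "b = b' * ?t ^ nat (val s b)"
      using polys_factor[OF ab(2,3)] by blast
    have "val s P = val s a - val s b"
      using ab \<open>a \<noteq> 0\<close> by (simp add: val_divide)
    then have "nat (val s a) = nat (val s a - val s b) + nat (val s b)"
      using P polys_integral(1)[OF ab(2)] by (simp flip: nat_add_distrib)
    then have "a = a' * ?t ^ nat (val s a - val s b) * ?t ^ nat (val s b)"
      using a'(2) by (simp add: power_add mult.assoc)
    then have "P = (a' * ?t ^ nat (val s a - val s b)) / b'"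
      using ab(4) b'(3) unif_nonzero by (metis mult_divide_mult_cancel_right power_not_zero)
    then show ?thesis
      unfolding carrier_dvr_eq using a' b' polys_mult[OF a'(1) polys_power[OF polys_unif]] by blast
  qed
qed

lemma reduct_in_res_field:
  assumes "P \<in> point_field \<X> x" "0 \<le> val s P"
  shows "reduct s P \<in> res_field \<X> x s"
proof -
  have "P \<in> carrier (dvr \<X> x s)"
    using assms by (simp add: dvr_iff)
  then obtain a b where "a \<in> polys" "b \<in> polys" "reduct s b \<noteq> 0" "P = a / b"
    unfolding carrier_dvr_eq by blast
  then show ?thesis
    using polys_integral[of a] polys_integral[of b] by (simp add: integral_divide(2) res_field_closed)
qed

text \<open>\<open>P - reduct s P\<close> has residue 0 and is thus divisible by the uniformizer.
  Conversely \<open>reduct s\<close> kills multiples of the uniformizer and fixes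
  \<open>res_field\<close>, so no other representative is possible.\<close>

lemma residue_eq:
  assumes P: "P \<in> point_field \<X> x" "0 \<le> val s P"
  shows "residue \<X> x s P = reduct s P"
  unfolding residue_def
proof (rule the_equality)
  let ?t = "unif \<X> x s"
  have PIdl: "PIdl\<^bsub>dvr \<X> x s\<^esub> ?t = {q * ?t | q. q \<in> point_field \<X> x \<and> 0 \<le> val s q}"
    unfolding cgenideal_def dvr_iff by (simp add: dvr_def)
  let ?c = "reduct s P"
  have c: "?c \<in> res_field \<X> x s"
    by (rule reduct_in_res_field[OF P])
  have int: "0 \<le> val s (P - ?c)"
    using P c by (intro integral_diff) (simp_all add: val_res_field)
  have "0 \<le> val s ((P - ?c) / ?t)"
  \<comment> \<open>Since \<open>val s 0 = 0\<close>, a vanishing difference does not count as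
    having positive valuation and is treated apart.\<close>
  proof (cases "P = ?c")
    case False
    then have "0 < val s (P - ?c)"
      using reduct_eq_0_iff[OF int] by (simp add: reduct_res_field[OF c])
    then show ?thesis
      using False by (simp add: val_divide unif_nonzero val_unif)
  next
    case True
    then show ?thesis
      by (metis div_0 order_refl right_minus_eq val_0)
  qed
  moreover have "(P - ?c) / ?t \<in> point_field \<X> x"
    using P c res_field_subset by (intro point_field_closed unif_in_point_field) auto
  moreover have "P - ?c = (P - ?c) / ?t * ?t"
    by (simp add: unif_nonzero)
  ultimately show "?c \<in> res_field \<X> x s \<and> P - ?c \<in> PIdl\<^bsub>dvr \<X> x s\<^esub> ?t"
    unfolding PIdl using c by blast
next
  let ?t = "unif \<X> x s"
  fix c
  assume c: "c \<in> res_field \<X> x s \<and> P - c \<in> PIdl\<^bsub>dvr \<X> x s\<^esub> ?t"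
  then obtain q where q: "q \<in> carrier (dvr \<X> x s)" "P - c = q * ?t"
    unfolding cgenideal_def by (auto simp: dvr_def)
  then have "reduct s (P - c) = 0"
    unfolding dvr_iff by (simp add: reduct_mult val_unif reduct_unif)
  then show "c = reduct s P"
    using c by (simp add: reduct_res_field)
qed

end

end

lemma val_power_int: "P \<noteq> 0 \<Longrightarrow> val s (P powi e) = e * val s P"
  by (simp add: power_int_def)

lemma adjoin_power_int: "P \<in> adjoin S \<Longrightarrow> P powi e \<in> adjoin S"
  by (simp add: power_int_def adjoin_closed)

lemma cring_ratfun_subset:
  assumes "1 \<in> S" "\<And>P Q. P \<in> S \<Longrightarrow> Q \<in> S \<Longrightarrow> P + Q \<in> S"
    "\<And>P Q. P \<in> S \<Longrightarrow> Q \<in> S \<Longrightarrow> P * Q \<in> S" "\<And>P. P \<in> S \<Longrightarrow> - P \<in> S"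
  shows "cring (ratfun_ring\<lparr>carrier := S\<rparr>)"
proof -
  have "0 \<in> S"
    using assms(1) assms(2)[of 1 "- 1"] assms(4)[of 1] by simp
  show ?thesis
  proof (intro cringI abelian_groupI comm_monoidI)
    fix P
    assume "P \<in> carrier (ratfun_ring\<lparr>carrier := S\<rparr>)"
    then show "\<exists>Q\<in>carrier (ratfun_ring\<lparr>carrier := S\<rparr>). Q \<oplus>\<^bsub>ratfun_ring\<lparr>carrier := S\<rparr>\<^esub> P = \<zero>\<^bsub>ratfun_ring\<lparr>carrier := S\<rparr>\<^esub>"
      by (intro bexI[of _ "- P"]) (simp_all add: assms(4))
  qed (use \<open>0 \<in> S\<close> in \<open>simp_all add: assms(1-3) algebra_simps\<close>)
qed

context kolmogoroff
begin

text \<open>The height function: by transitivity it strictly increases from a point to its proper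
  generizations.\<close>

lemma card_specializations_less:
  assumes "s \<in> specializations \<X> x"
  shows "card (specializations \<X> s) < card (specializations \<X> x)"
proof (rule psubset_card_mono[OF finite_specializations])
  have "s \<notin> specializations \<X> s"
    by (simp add: specializations_iff)
  moreover have "specializations \<X> s \<subseteq> specializations \<X> x"
    using specializations_trans[OF _ assms] by blast
  ultimately show "specializations \<X> s \<subset> specializations \<X> x"
    using assms by blast
qed

section \<open>The semilocal rings\<close>

text \<open>A triangular system of valuations, solved with integer exponents. Points come in order
  of non-increasing height, so no earlier point is a specialization of the new point
  \<open>b\<close>, and the factor added for \<open>b\<close> leaves the earlier values
  alone.\<close>

lemma exists_monomial_with_vals:
  assumes "finite B" "B \<subseteq> specializations \<X> x"
  shows "\<exists>m\<in>(point_field \<X> x :: ('a set, 'k::field) ratfun set). m \<noteq> 0 \<and> (\<forall>s\<in>B. val s m = w s)"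
  using assms
proof (induction B rule: finite_ranking_induct[where f = "\<lambda>b. - int (card (specializations \<X> b))"])
  case empty
  show ?case
    by (rule bexI[of _ 1]) auto
next
  case (insert b B)
  then obtain m where m: "m \<in> (point_field \<X> x :: ('a set, 'k) ratfun set)" "m \<noteq> 0" "\<forall>s\<in>B. val s m = w s"
    by auto
  show ?case
  proof (cases "b \<in> B")
    case True
    then show ?thesis
      using m by (auto simp: insert_absorb)
  next
    case False
    \<comment> \<open>The largest open set missing \<open>b\<close>; its indeterminate has valuation
      1 on the closure of \<open>b\<close> and 0 at all other points. The exponent below corrects
      the valuation at \<open>b\<close> and may be negative.\<close>
    let ?W = "topspace \<X> - \<X> closure_of {b}"
    let ?m = "m * indet ?W powi (w b - val b m)"
    have b: "b \<in> specializations \<X> x"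
      using insert.prems by simp
    have W: "openin \<X> ?W"
      by (rule openin_diff) auto
    obtain U where "openin \<X> U" "x \<in> U" "b \<notin> U"
      using separating_open[OF b] by blast
    then have "x \<notin> \<X> closure_of {b}" "x \<in> topspace \<X>"
      using b by (auto simp only: in_closure_of specializations_iff)
    then have "indet ?W \<in> point_field \<X> x"
      using W by (intro indet_in_point_field) auto
    then have "?m \<in> point_field \<X> x"
      using m(1) unfolding point_field_def by (intro adjoin_mult adjoin_power_int)
    moreover have "?m \<noteq> 0"
      using m(2) by simp
    moreover have "val s ?m = w s" if "s \<in> insert b B" for s
    proof (cases "s = b")
      case True
      have "b \<notin> ?W"
        by (simp add: in_closure_of)
      then show ?thesis
        unfolding True using m(2) by (simp add: val_mult val_power_int val_indet del: Diff_iff)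
    next
      case False
      then have "s \<in> B"
        using that by simp
      then have "s \<notin> specializations \<X> b"
        using insert.hyps(2)[of s] card_specializations_less[of s b] by auto
      moreover have "s \<in> topspace \<X>"
        using \<open>s \<in> B\<close> insert.prems by (auto simp only: specializations_iff)
      ultimately have "s \<in> ?W"
        using False by (simp add: specializations_def)
      then show ?thesis
        using m \<open>s \<in> B\<close> by (simp add: val_mult val_power_int val_indet del: Diff_iff)
    qed
    ultimately show ?thesis
      by blast
  qed
qed

lemma local_ring_eq:
  "(local_ring \<X> x :: ('a set, 'k::field) ratfun ring)
     = ratfun_ring\<lparr>carrier := {P \<in> point_field \<X> x. \<forall>s\<in>specializations \<X> x. 0 \<le> val s P}\<rparr>"
proof -
  have "(point_field \<X> x :: ('a set, 'k) ratfun set) \<inter> (\<Inter>s\<in>specializations \<X> x. carrier (dvr \<X> x s))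
      = {P \<in> point_field \<X> x. \<forall>s\<in>specializations \<X> x. 0 \<le> val s P}"
    using dvr_iff by auto
  then show ?thesis
    by (simp add: local_ring_def)
qed

lemma carrier_local_ring:
  "carrier (local_ring \<X> x) = {P \<in> point_field \<X> x. \<forall>s\<in>specializations \<X> x. 0 \<le> val s P}"
  by (simp add: local_ring_eq)

lemma cring_local_ring: "cring (local_ring \<X> x)"
  unfolding local_ring_eq
  by (rule cring_ratfun_subset) (auto intro: integral_add integral_mult)

lemma local_ring_simps [simp]:
  "mult (local_ring \<X> x) P Q = P * Q" "one (local_ring \<X> x) = 1"
  "zero (local_ring \<X> x) = 0" "add (local_ring \<X> x) P Q = P + Q"
  by (simp_all add: local_ring_def)

text \<open>A strictly larger ideal contains some \<open>a\<close> with nonzero residue at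
  \<open>s\<close>. Adding an element of \<open>M\<close> whose residues vanish exactly where those
  of \<open>a\<close> do not gives nonzero residues everywhere, hence a unit.\<close>

lemma maximalideal_reduct:
  fixes x s :: 'a
  assumes s: "s \<in> specializations \<X> x"
  defines "A \<equiv> local_ring \<X> x :: ('a set, 'k::field) ratfun ring"
  defines "M \<equiv> {P \<in> carrier A. reduct s P = 0}"
  shows "maximalideal M A"
proof (rule maximalidealI)
  interpret cring A
    unfolding A_def by (rule cring_local_ring)
  have uminus: "\<ominus>\<^bsub>A\<^esub> P = - P" if "P \<in> carrier A" for P
    using that by (intro minus_equality) (auto simp: A_def carrier_local_ring)
  have val: "0 \<le> val s P" if "P \<in> carrier A" for P
    using that s by (simp add: A_def carrier_local_ring)
  have M: "P \<in> M \<longleftrightarrow> P \<in> carrier A \<and> reduct s P = 0" for P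
    by (simp add: M_def)
  have A_simps: "P \<oplus>\<^bsub>A\<^esub> Q = P + Q" "P \<otimes>\<^bsub>A\<^esub> Q = P * Q" "\<one>\<^bsub>A\<^esub> = 1" "\<zero>\<^bsub>A\<^esub> = 0" for P Q
    by (simp_all add: A_def)
  show "ideal M A"
  proof (rule idealI[OF ring_axioms])
    show "subgroup M (add_monoid A)"
    proof (rule add.subgroupI)
      show "M \<subseteq> carrier A"
        by (simp add: M_def)
      have "0 \<in> M"
        using zero_closed by (simp add: M A_simps)
      then show "M \<noteq> {}"
        by blast
      show "\<ominus>\<^bsub>A\<^esub> P \<in> M" if "P \<in> M" for P
        using that uminus a_inv_closed[of P] by (simp add: M)
      show "P \<oplus>\<^bsub>A\<^esub> Q \<in> M" if "P \<in> M" "Q \<in> M" for P Q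
        using that a_closed[of P Q] by (simp add: M A_simps)
    qed
    show "Q \<otimes>\<^bsub>A\<^esub> P \<in> M" "P \<otimes>\<^bsub>A\<^esub> Q \<in> M" if "P \<in> M" "Q \<in> carrier A" for P Q
      using that m_closed[of P Q] m_closed[of Q P] val by (simp_all add: M A_simps reduct_mult)
  qed
  have "1 \<in> carrier A"
    using one_closed by (simp add: A_def)
  moreover have "1 \<notin> M"
    by (simp add: M)
  ultimately show "carrier A \<noteq> M"
    by blast
  fix J
  assume J: "ideal J A" "M \<subseteq> J" "J \<subseteq> carrier A"
  interpret J: ideal J A
    by (rule J(1))
  show "J = M \<or> J = carrier A"
  proof (rule disjCI)
    assume "J \<noteq> carrier A"
    show "J = M"
    proof (rule ccontr)
      assume "J \<noteq> M"
      then obtain a where a: "a \<in> J" "reduct s a \<noteq> 0" "a \<in> carrier A"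
        using J unfolding M_def by blast
      \<comment> \<open>Valuation 1 makes the residue of \<open>m\<close> vanish where
        \<open>a\<close> has a nonzero one, valuation 0 keeps it nonzero elsewhere; in particular
        \<open>m\<close> has residue 0 at \<open>s\<close>.\<close>
      define w :: "'a \<Rightarrow> int" where "w t = (if reduct t a = 0 then 0 else 1)" for t
      obtain m where m: "m \<in> (point_field \<X> x :: ('a set, 'k) ratfun set)" "m \<noteq> 0" "\<And>t. t \<in> specializations \<X> x \<Longrightarrow> val t m = w t"
        using exists_monomial_with_vals[OF finite_specializations order_refl, of x w] by metis
      have reduct_m: "reduct t m = 0 \<longleftrightarrow> reduct t a \<noteq> 0" if "t \<in> specializations \<X> x" for t
        using reduct_eq_0_iff[of t m] m(2) m(3)[OF that] by (simp add: w_def)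
      have mA: "m \<in> carrier A"
        using m by (auto simp: A_def carrier_local_ring w_def)
      then have "m \<in> J"
        using J(2) reduct_m[OF s] a(2) by (auto simp: M_def)
      then have u: "a + m \<in> J"
        using J.a_closed[OF a(1), of m] by (simp add: A_def)
      then have uA: "a + m \<in> carrier A"
        using J(3) by blast
      have unit: "reduct t (a + m) \<noteq> 0" if "t \<in> specializations \<X> x" for t
        using reduct_m[OF that] by auto
      have "0 \<le> val t (inverse (a + m))" if "t \<in> specializations \<X> x" for t
        using uA that by (intro integral_inverse(1) unit) (auto simp: A_def carrier_local_ring)
      then have "inverse (a + m) \<in> carrier A"
        using uA by (auto simp: A_def carrier_local_ring)
      then have "inverse (a + m) \<otimes>\<^bsub>A\<^esub> (a + m) \<in> J"
        using u by (rule J.I_l_closed[rotated])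
      moreover have "a + m \<noteq> 0"
        using unit[OF s] reduct_0[of s] by metis
      ultimately have "\<one>\<^bsub>A\<^esub> \<in> J"
        by (simp add: A_def)
      then show False
        using J.one_imp_carrier \<open>J \<noteq> carrier A\<close> by blast
    qed
  qed
qed

lemma reduct_Jac:
  assumes "s \<in> specializations \<X> x" "P \<in> Jac (local_ring \<X> x)"
  shows "reduct s P = 0"
  using assms(2) maximalideal_reduct[OF assms(1)] unfolding Jac_def by blast

lemma zero_in_Jac: "0 \<in> Jac (local_ring \<X> x :: ('a set, 'k::field) ratfun ring)"
proof -
  have "0 \<in> \<mm>" if "maximalideal \<mm> (local_ring \<X> x)" for \<mm> :: "('a set, 'k) ratfun set"
  proof -
    interpret maximalideal \<mm> "local_ring \<X> x"
      by (rule that)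
    show ?thesis
      using additive_subgroup.zero_closed[OF is_additive_subgroup] by simp
  qed
  then show ?thesis
    by (auto simp: Jac_def carrier_local_ring)
qed

text \<open>The radical lies in the kernel of every \<open>reduct s\<close>, so
  \<open>residues\<close> is constant on the coset. The coset contains \<open>P\<close> because 0 is
  in the radical, so the image is a singleton, as \<open>the_elem\<close> requires.\<close>

lemma jac_quot_iso_coset:
  assumes P: "P \<in> carrier (local_ring \<X> x)"
  shows "jac_quot_iso \<X> x (Jac (local_ring \<X> x) +>\<^bsub>local_ring \<X> x\<^esub> P)
    = (\<lambda>s\<in>specializations \<X> x. reduct s P)"
proof -
  let ?r = "\<lambda>s\<in>specializations \<X> x. reduct s P"
  have "residues \<X> x (h + P) = ?r" if h: "h \<in> Jac (local_ring \<X> x)" for h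
  proof -
    have "h \<in> carrier (local_ring \<X> x)"
      using h by (simp add: Jac_def)
    then have "residue \<X> x s (h + P) = reduct s P" if "s \<in> specializations \<X> x" for s
      using P that reduct_Jac[OF that h]
      by (subst residue_eq) (auto simp: carrier_local_ring intro: integral_add)
    then show ?thesis
      by (auto simp: residues_def)
  qed
  then have "residues \<X> x ` (Jac (local_ring \<X> x) +>\<^bsub>local_ring \<X> x\<^esub> P) = {?r}"
    using zero_in_Jac[of x] by (auto simp: a_r_coset_def' image_UN)
  then show ?thesis
    by (simp add: jac_quot_iso_def)
qed

section \<open>The ring of a space\<close>

lemma specializations_closed: "closedin \<X> {x} \<Longrightarrow> specializations \<X> x = {}"
  by (simp add: specializations_def closure_of_closedin)

text \<open>The form of the definition that all later arguments use. A closed point has no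
  specializations, so its gluing condition is empty and one formula covers all points.\<close>

lemma carrier_R_ring:
  "carrier (R_ring TYPE('k::field) \<X>) = {P \<in> \<Pi>\<^sub>E x\<in>topspace \<X>. point_field \<X> x.
     \<forall>x\<in>topspace \<X>. \<forall>s\<in>specializations \<X> x. 0 \<le> val s (P x) \<and> reduct s (P x) = P s}"
  (is "?L = ?R")
proof (intro Set.set_eqI iffI)
  fix P
  assume P: "P \<in> ?L"
  then have loc: "P \<in> (\<Pi>\<^sub>E x\<in>topspace \<X>. carrier (local_ring \<X> x))"
    by (simp add: R_ring_def)
  moreover have "reduct s (P x) = P s" if "x \<in> topspace \<X>" "s \<in> specializations \<X> x" for x s
  proof -
    have "\<not> closedin \<X> {x}"
      using specializations_closed that by blast
    moreover have "P x \<in> carrier (local_ring \<X> x)"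
      using loc that by blast
    moreover have "jac_quot_iso \<X> x (Jac (local_ring \<X> x) +>\<^bsub>local_ring \<X> x\<^esub> P x)
        = restrict P (specializations \<X> x)"
      using P that(1) \<open>\<not> closedin \<X> {x}\<close> by (simp add: R_ring_def)
    ultimately have "(\<lambda>s\<in>specializations \<X> x. reduct s (P x)) = restrict P (specializations \<X> x)"
      using jac_quot_iso_coset by metis
    then show ?thesis
      using that by (metis restrict_apply')
  qed
  ultimately show "P \<in> ?R"
    by (auto simp: carrier_local_ring PiE_iff)
next
  fix P
  assume P: "P \<in> ?R"
  then have loc: "P \<in> (\<Pi>\<^sub>E x\<in>topspace \<X>. carrier (local_ring \<X> x))"
    by (auto simp: carrier_local_ring PiE_iff)
  have "jac_quot_iso \<X> x (Jac (local_ring \<X> x) +>\<^bsub>local_ring \<X> x\<^esub> P x)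
         = restrict P (specializations \<X> x)" if "x \<in> topspace \<X>" for x
  proof -
    have "P x \<in> carrier (local_ring \<X> x)"
      using loc that by blast
    then show ?thesis
      using P that by (auto simp: jac_quot_iso_coset)
  qed
  then show "P \<in> ?L"
    using loc by (simp add: R_ring_def)
qed

lemma R_ring_simps [simp]:
  "mult (R_ring TYPE('k::field) \<X>) P Q = (\<lambda>x\<in>topspace \<X>. P x * Q x)"
  "add (R_ring TYPE('k::field) \<X>) P Q = (\<lambda>x\<in>topspace \<X>. P x + Q x)"
  "one (R_ring TYPE('k::field) \<X>) = (\<lambda>x\<in>topspace \<X>. 1)"
  "zero (R_ring TYPE('k::field) \<X>) = (\<lambda>x\<in>topspace \<X>. 0)"
  by (simp_all add: R_ring_def F_ring_def prod_ring_def cong: restrict_cong)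

lemma R_ringI:
  assumes "\<And>x. x \<in> topspace \<X> \<Longrightarrow> P x \<in> point_field \<X> x"
    and "\<And>x s. x \<in> topspace \<X> \<Longrightarrow> s \<in> specializations \<X> x \<Longrightarrow> 0 \<le> val s (P x)"
    and "\<And>x s. x \<in> topspace \<X> \<Longrightarrow> s \<in> specializations \<X> x \<Longrightarrow> reduct s (P x) = P s"
  shows "restrict P (topspace \<X>) \<in> carrier (R_ring TYPE('k::field) \<X>)"
  using assms by (auto simp: carrier_R_ring specializations_iff)

lemma R_ringD:
  assumes "P \<in> carrier (R_ring TYPE('k::field) \<X>)" "x \<in> topspace \<X>"
  shows "P x \<in> point_field \<X> x"
    and "s \<in> specializations \<X> x \<Longrightarrow> 0 \<le> val s (P x)"
    and "s \<in> specializations \<X> x \<Longrightarrow> reduct s (P x) = P s"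
  using assms by (auto simp: carrier_R_ring)

lemma R_ring_extensional: "P \<in> carrier (R_ring TYPE('k::field) \<X>) \<Longrightarrow> P \<in> extensional (topspace \<X>)"
  by (simp add: carrier_R_ring PiE_def)

lemma cring_R_ring: "cring (R_ring TYPE('k::field) \<X>)"
proof (intro cringI abelian_groupI comm_monoidI)
  let ?R = "R_ring TYPE('k) \<X>"
  show "P \<oplus>\<^bsub>?R\<^esub> Q \<in> carrier ?R" if "P \<in> carrier ?R" "Q \<in> carrier ?R" for P Q
    using that by (auto intro!: R_ringI simp: R_ringD integral_add)
  show "P \<otimes>\<^bsub>?R\<^esub> Q \<in> carrier ?R" if "P \<in> carrier ?R" "Q \<in> carrier ?R" for P Q
    using that by (auto intro!: R_ringI simp: R_ringD integral_mult reduct_mult)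
  show "\<one>\<^bsub>?R\<^esub> \<in> carrier ?R" "\<zero>\<^bsub>?R\<^esub> \<in> carrier ?R"
    by (auto intro!: R_ringI)
  show "\<exists>Q\<in>carrier ?R. Q \<oplus>\<^bsub>?R\<^esub> P = \<zero>\<^bsub>?R\<^esub>" if "P \<in> carrier ?R" for P
  proof (rule bexI)
    show "(\<lambda>x\<in>topspace \<X>. - P x) \<in> carrier ?R"
      using that by (auto intro!: R_ringI simp: R_ringD)
  qed (simp cong: restrict_cong)
qed (auto intro!: extensionalityI[of _ "topspace \<X>"] dest: R_ring_extensional simp: algebra_simps)

section \<open>Prime ideals\<close>

lemma spec_point_eq:
  "spec_point TYPE('k::field) \<X> a = {P \<in> carrier (R_ring TYPE('k) \<X>). P a = 0}"
  by (simp add: spec_point_def a_kernel_def')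

lemma spec_point_specialization:
  assumes "s \<in> specializations \<X> x" "P \<in> carrier (R_ring TYPE('k::field) \<X>)" "P x = 0"
  shows "P s = 0"
proof -
  have "x \<in> topspace \<X>"
    using assms(1) by (simp add: specializations_iff)
  then show ?thesis
    using R_ringD(3)[OF assms(2) _ assms(1)] assms(3) by simp
qed

lemma primeideal_spec_point:
  assumes a: "a \<in> topspace \<X>"
  shows "primeideal (spec_point TYPE('k::field) \<X> a) (R_ring TYPE('k) \<X>)"
proof -
  let ?R = "R_ring TYPE('k) \<X>"
  interpret cring ?R
    by (rule cring_R_ring)
  have add: "(P \<oplus>\<^bsub>?R\<^esub> Q) a = P a + Q a" and mult: "(P \<otimes>\<^bsub>?R\<^esub> Q) a = P a * Q a" for P Q
    using a by simp_all
  have zero: "\<zero>\<^bsub>?R\<^esub> a = 0" and one: "\<one>\<^bsub>?R\<^esub> a = 1"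
    using a by simp_all
  have uminus: "(\<ominus>\<^bsub>?R\<^esub> P) a = - P a" if "P \<in> carrier ?R" for P
  proof -
    have "P a + (\<ominus>\<^bsub>?R\<^esub> P) a = 0"
      unfolding add[symmetric] r_neg[OF that] by (rule zero)
    then show ?thesis
      by (simp add: eq_neg_iff_add_eq_0 add.commute)
  qed
  have mem: "P \<in> spec_point TYPE('k) \<X> a \<longleftrightarrow> P \<in> carrier ?R \<and> P a = 0" for P
    by (simp add: spec_point_eq)
  show ?thesis
  proof (rule primeidealI[OF idealI])
    show "subgroup (spec_point TYPE('k) \<X> a) (add_monoid ?R)"
    proof (rule add.subgroupI)
      show "spec_point TYPE('k) \<X> a \<subseteq> carrier ?R"
        using mem by blast
      show "spec_point TYPE('k) \<X> a \<noteq> {}"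
        using zero zero_closed mem by blast
      show "\<ominus>\<^bsub>?R\<^esub> P \<in> spec_point TYPE('k) \<X> a" if "P \<in> spec_point TYPE('k) \<X> a" for P
        using that unfolding mem by (simp add: uminus)
      show "P \<oplus>\<^bsub>?R\<^esub> Q \<in> spec_point TYPE('k) \<X> a"
        if "P \<in> spec_point TYPE('k) \<X> a" "Q \<in> spec_point TYPE('k) \<X> a" for P Q
        using that unfolding mem add by (simp del: R_ring_simps)
    qed
    show "Q \<otimes>\<^bsub>?R\<^esub> P \<in> spec_point TYPE('k) \<X> a" "P \<otimes>\<^bsub>?R\<^esub> Q \<in> spec_point TYPE('k) \<X> a"
      if "P \<in> spec_point TYPE('k) \<X> a" "Q \<in> carrier ?R" for P Q
      using that unfolding mem mult by (simp_all del: R_ring_simps)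
    show "P \<in> spec_point TYPE('k) \<X> a \<or> Q \<in> spec_point TYPE('k) \<X> a"
      if "P \<in> carrier ?R" "Q \<in> carrier ?R" "P \<otimes>\<^bsub>?R\<^esub> Q \<in> spec_point TYPE('k) \<X> a" for P Q
      using that unfolding mem mult by (simp del: R_ring_simps)
    show "carrier ?R \<noteq> spec_point TYPE('k) \<X> a"
      using one one_closed mem by (metis zero_neq_one)
    show "cring ?R" "ring ?R"
      by (rule is_cring ring_axioms)+
  qed
qed

section \<open>Elements with prescribed zeros\<close>

definition open_section :: "'a set \<Rightarrow> 'a \<Rightarrow> ('a set, 'k::field) ratfun" where
  "open_section U = (\<lambda>x\<in>topspace \<X>. if x \<in> U then indet U else 0)"

lemma reduct_indet: "reduct s (indet U) = (if s \<in> U then indet U else 0)"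
  by (simp add: reduct_def expand_indet)

text \<open>Openness rules out that \<open>U\<close> contains a specialization \<open>s\<close> but
  not \<open>x\<close>. If it contains only \<open>x\<close>, then \<open>indet U\<close> has
  valuation 1 at \<open>s\<close> and its residue is 0, as the gluing demands.\<close>

lemma open_section_in_R_ring:
  assumes "openin \<X> U"
  shows "open_section U \<in> carrier (R_ring TYPE('k::field) \<X>)"
  unfolding open_section_def
proof (rule R_ringI)
  show "(if x \<in> U then indet U else 0) \<in> point_field \<X> x" for x
    using assms indet_in_point_field by auto
  fix x s
  assume s: "s \<in> specializations \<X> x"
  then have "s \<in> U \<Longrightarrow> x \<in> U"
    using assms by (auto simp only: specializations_iff)
  then show "0 \<le> val s (if x \<in> U then indet U else 0)"
    "reduct s (if x \<in> U then indet U else 0) = (if s \<in> U then indet U else 0)"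
    by (auto simp: val_indet reduct_indet)
qed

text \<open>The residue of \<open>P x\<close> at \<open>s\<close> is \<open>P s\<close> and hence
  nonzero, so the pointwise inverse is integral and its residues are the inverse values.\<close>

lemma R_ring_nonvanishing_unit:
  assumes P: "P \<in> carrier (R_ring TYPE('k::field) \<X>)" and "\<And>x. x \<in> topspace \<X> \<Longrightarrow> P x \<noteq> 0"
  shows "\<exists>Q\<in>carrier (R_ring TYPE('k) \<X>). Q \<otimes>\<^bsub>R_ring TYPE('k) \<X>\<^esub> P = \<one>\<^bsub>R_ring TYPE('k) \<X>\<^esub>"
proof
  show "(\<lambda>x\<in>topspace \<X>. inverse (P x)) \<otimes>\<^bsub>R_ring TYPE('k) \<X>\<^esub> P = \<one>\<^bsub>R_ring TYPE('k) \<X>\<^esub>"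
    using assms(2) by (simp cong: restrict_cong)
  show "(\<lambda>x\<in>topspace \<X>. inverse (P x)) \<in> carrier (R_ring TYPE('k) \<X>)"
  proof (rule R_ringI)
    fix x
    assume x: "x \<in> topspace \<X>"
    then show "inverse (P x) \<in> point_field \<X> x"
      using R_ringD(1)[OF P] by blast
    fix s
    assume s: "s \<in> specializations \<X> x"
    then have "reduct s (P x) \<noteq> 0"
      using R_ringD(3)[OF P x s] assms(2)[of s] by (simp add: specializations_iff)
    then show "0 \<le> val s (inverse (P x))" "reduct s (inverse (P x)) = inverse (P s)"
      using integral_inverse[OF R_ringD(2)[OF P x s]] R_ringD(3)[OF P x s] by simp_all
  qed
qed

lemma open_upset:
  assumes "a \<in> topspace \<X>"
  shows "openin \<X> (insert a {b. a \<in> specializations \<X> b})"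
proof (rule openin_generalizing)
  show "insert a {b. a \<in> specializations \<X> b} \<subseteq> topspace \<X>"
    using assms by (auto simp only: specializations_iff)
qed (use specializations_trans in blast)

text \<open>Points come in order of non-decreasing height. If \<open>Q\<close> vanishes at the new
  point \<open>b\<close>, a multiple of \<open>P\<close> supported on the smallest neighbourhood of
  \<open>b\<close> is added; earlier points are not generizations of \<open>b\<close>, so the values
  there stay.\<close>

lemma ideal_nonvanishing_element:
  assumes I: "ideal I (R_ring TYPE('k::field) \<X>)"
    and "finite B" "B \<subseteq> topspace \<X>" "\<And>b. b \<in> B \<Longrightarrow> \<exists>P\<in>I. P b \<noteq> 0"
  shows "\<exists>Q\<in>I. \<forall>b\<in>B. Q b \<noteq> 0"
  using assms(2-)
proof (induction B rule: finite_ranking_induct[where f = "\<lambda>b. card (specializations \<X> b)"])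
  case empty
  then show ?case
    using additive_subgroup.zero_closed[OF ideal.axioms(1)[OF I]] by blast
next
  case (insert b B)
  interpret ideal I "R_ring TYPE('k) \<X>"
    by (rule I)
  obtain Q where Q: "Q \<in> I" "\<forall>b\<in>B. Q b \<noteq> 0"
    using insert.IH insert.prems by blast
  obtain P where P: "P \<in> I" "P b \<noteq> 0"
    using insert.prems by blast
  show ?case
  proof (cases "Q b = 0 \<and> b \<notin> B")
    case True
    let ?U = "insert b {x. b \<in> specializations \<X> x}"
    let ?t = "open_section ?U :: 'a \<Rightarrow> ('a set, 'k) ratfun"
    have U: "openin \<X> ?U"
      using insert.prems(1) by (intro open_upset) blast
    have "?t \<otimes>\<^bsub>R_ring TYPE('k) \<X>\<^esub> P \<in> I"
      by (rule I_l_closed[OF P(1) open_section_in_R_ring[OF U]])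
    then have "Q \<oplus>\<^bsub>R_ring TYPE('k) \<X>\<^esub> (?t \<otimes>\<^bsub>R_ring TYPE('k) \<X>\<^esub> P) \<in> I"
      by (rule additive_subgroup.a_closed[OF is_additive_subgroup Q(1)])
    moreover have "(Q \<oplus>\<^bsub>R_ring TYPE('k) \<X>\<^esub> (?t \<otimes>\<^bsub>R_ring TYPE('k) \<X>\<^esub> P)) c \<noteq> 0" if c: "c \<in> insert b B" for c
    proof -
      have cX: "c \<in> topspace \<X>"
        using c insert.prems(1) by blast
      show ?thesis
      proof (cases "c = b")
        case True
        then show ?thesis
          using \<open>Q b = 0 \<and> b \<notin> B\<close> cX P(2) by (simp add: open_section_def)
      next
        case False
        then have "c \<in> B"
          using c by blast
        then have "b \<notin> specializations \<X> c"
          using insert.hyps(2)[of c] card_specializations_less[of b c] by linarith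
        then show ?thesis
          using Q(2) \<open>c \<in> B\<close> cX False by (simp add: open_section_def)
      qed
    qed
    ultimately show ?thesis
      by blast
  next
    case False
    then show ?thesis
      using Q by blast
  qed
qed

text \<open>
  If \<open>Q\<close> vanishes at \<open>a\<close> but at no proper generization of \<open>a\<close>, then the quotient \<open>(t P)\<^sup>n / Q\<close>, where
  \<open>t\<close> is supported on the smallest open neighbourhood of \<open>a\<close>, satisfies the gluing conditions as
  soon as \<open>n\<close> exceeds all valuations of \<open>Q\<close>.
\<close>

lemma power_divisible:
  fixes P Q :: "'a \<Rightarrow> ('a set, 'k::field) ratfun"
  assumes a: "a \<in> topspace \<X>"
    and P: "P \<in> carrier (R_ring TYPE('k) \<X>)" "P a = 0"
    and Q: "Q \<in> carrier (R_ring TYPE('k) \<X>)" "Q a = 0"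
    and nonvanishing: "\<And>b. a \<in> specializations \<X> b \<Longrightarrow> Q b \<noteq> 0"
  defines "t \<equiv> open_section (insert a {b. a \<in> specializations \<X> b})"
  shows "\<exists>n. \<exists>Z\<in>carrier (R_ring TYPE('k) \<X>).
    (\<lambda>x\<in>topspace \<X>. (t x * P x) ^ n) = Z \<otimes>\<^bsub>R_ring TYPE('k) \<X>\<^esub> Q"
proof -
  let ?B = "{b. a \<in> specializations \<X> b}"
  let ?U = "insert a ?B"
  have U: "openin \<X> ?U"
    by (rule open_upset[OF a])
  let ?V = "(\<lambda>(s, x). nat (val s (Q x))) ` (topspace \<X> \<times> topspace \<X>)"
  \<comment> \<open>The successor makes \<open>n\<close> strictly larger than the valuations, so
    that \<open>Z\<close> will have positive valuation, and makes \<open>n\<close> positive, so that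
    \<open>0 ^ n = 0\<close> where \<open>t\<close> or \<open>P\<close> vanishes.\<close>
  define n where "n = Suc (Max ?V)"
  have n: "val s (Q x) < int n" if "s \<in> topspace \<X>" "x \<in> topspace \<X>" for s x
  proof -
    have "nat (val s (Q x)) \<le> Max ?V"
      using that finite_topspace by (intro Max_ge) auto
    then show ?thesis
      by (simp add: n_def)
  qed
  define M where "M x = indet ?U * P x" for x
  \<comment> \<open>At \<open>a\<close> both \<open>P\<close> and \<open>Q\<close> vanish; the value
    0 there is compatible with the product identity and is what residues from the generizations have
    to match.\<close>
  define Z where "Z x = (if x \<in> ?B then M x ^ n / Q x else 0)" for x
  have top: "b \<in> topspace \<X>" if "b \<in> ?B" for b
    using that by (simp add: specializations_iff)
  have "restrict Z (topspace \<X>) \<in> carrier (R_ring TYPE('k) \<X>)"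
  proof (rule R_ringI)
    fix x
    assume x: "x \<in> topspace \<X>"
    show "Z x \<in> point_field \<X> x"
    proof (cases "x \<in> ?B")
      case True
      then have "indet ?U \<in> point_field \<X> x"
        by (intro indet_in_point_field[OF U]) blast
      then show ?thesis
        using R_ringD(1)[OF P(1) x] R_ringD(1)[OF Q(1) x] unfolding Z_def M_def point_field_def
        by (auto intro!: adjoin_closed)
    next
      case False
      then show ?thesis
        unfolding Z_def by auto
    qed
    fix s
    assume s: "s \<in> specializations \<X> x"
    then have sX: "s \<in> topspace \<X>"
      by (simp add: specializations_iff)
    have "0 \<le> val s (Z x) \<and> reduct s (Z x) = Z s"
    proof (cases "x \<in> ?B")
      case xB: True
      have val_M: "0 \<le> val s (M x)"
        unfolding M_def using R_ringD(2)[OF P(1) x s] by (intro integral_mult) (auto simp: val_indet)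
      have reduct_M: "reduct s (M x) = (if s \<in> ?U then indet ?U else 0) * P s"
        unfolding M_def using R_ringD(2,3)[OF P(1) x s] by (subst reduct_mult) (auto simp: val_indet reduct_indet)
      have "0 \<le> val s (M x ^ k) \<and> reduct s (M x ^ k) = reduct s (M x) ^ k" for k
        using val_M by (induction k) (auto simp: reduct_mult integral_mult simp del: val_power)
      note pow = this
      show ?thesis
      proof (cases "s \<in> ?B")
        case True
        then have "reduct s (Q x) \<noteq> 0"
          using R_ringD(3)[OF Q(1) x s] nonvanishing by simp
        from integral_divide[OF pow[THEN conjunct1] R_ringD(2)[OF Q(1) x s] this] show ?thesis
          using xB True reduct_M R_ringD(3)[OF Q(1) x s] by (simp add: Z_def pow M_def[of s])
      next
        case False
        \<comment> \<open>Either \<open>s = a\<close>, where \<open>P\<close> vanishes, or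
          \<open>s\<close> lies outside \<open>?U\<close>, where the residue of the indeterminate is
          0.\<close>
        then have "reduct s (M x) = 0"
          using P(2) by (auto simp: reduct_M)
        then have "M x = 0 \<or> 1 \<le> val s (M x)"
          using reduct_eq_0_iff[OF val_M] by auto
        then have "Z x = 0 \<or> 0 < val s (Z x)"
        proof
          assume "M x = 0"
          then show ?thesis
            by (simp add: Z_def n_def)
        next
          assume "1 \<le> val s (M x)"
          moreover from this have "M x \<noteq> 0"
            by auto
          moreover have "int n * 1 \<le> int n * val s (M x)"
            using \<open>1 \<le> val s (M x)\<close> by (intro mult_left_mono) simp_all
          ultimately have "int n \<le> int n * val s (M x)" "val s (M x ^ n / Q x) = int n * val s (M x) - val s (Q x)"
            using nonvanishing xB by (simp_all add: val_divide)
          then show ?thesis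
            using n[OF sX x] xB by (simp add: Z_def)
        qed
        then have *: "0 \<le> val s (Z x)" "reduct s (Z x) = 0"
          using reduct_eq_0_iff[of s "Z x"] by auto
        then show ?thesis
          using False by (simp add: Z_def[of s])
      qed
    next
      case False
      then have "s \<notin> ?B"
        using specializations_trans[OF _ s] by blast
      then show ?thesis
        using False by (simp add: Z_def)
    qed
    then show "0 \<le> val s (Z x)" "reduct s (Z x) = Z s"
      by blast+
  qed
  moreover have "(t x * P x) ^ n = Z x * Q x" if "x \<in> topspace \<X>" for x
    using that nonvanishing[of x] P(2) Q(2) by (auto simp: t_def open_section_def Z_def M_def n_def)
  then have "(\<lambda>x\<in>topspace \<X>. (t x * P x) ^ n) = restrict Z (topspace \<X>) \<otimes>\<^bsub>R_ring TYPE('k) \<X>\<^esub> Q"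
    by (simp cong: restrict_cong)
  ultimately show ?thesis
    by blast
qed

lemma primeideal_power:
  assumes p: "primeideal p (R_ring TYPE('k::field) \<X>)"
    and P: "P \<in> carrier (R_ring TYPE('k) \<X>)" and "(\<lambda>x\<in>topspace \<X>. P x ^ n) \<in> p"
  shows "P \<in> p"
  using assms(3)
proof (induction n)
  interpret primeideal p "R_ring TYPE('k) \<X>"
    by (rule p)
  case 0
  then have "\<one>\<^bsub>R_ring TYPE('k) \<X>\<^esub> \<in> p"
    by (simp only: R_ring_simps power_0)
  then show ?case
    using one_imp_carrier I_notcarr by blast
next
  interpret primeideal p "R_ring TYPE('k) \<X>"
    by (rule p)
  case (Suc n)
  have power_Suc: "P \<otimes>\<^bsub>R_ring TYPE('k) \<X>\<^esub> (\<lambda>x\<in>topspace \<X>. P x ^ k) = (\<lambda>x\<in>topspace \<X>. P x ^ Suc k)" for k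
    by (auto simp: restrict_def)
  have "(\<lambda>x\<in>topspace \<X>. P x ^ k) \<in> carrier (R_ring TYPE('k) \<X>)" for k
  proof (induction k)
    case 0
    then show ?case
      using one_closed by (simp only: R_ring_simps power_0)
  next
    case (Suc k)
    then show ?case
      using m_closed[OF P Suc] by (simp only: power_Suc)
  qed
  moreover have "P \<otimes>\<^bsub>R_ring TYPE('k) \<X>\<^esub> (\<lambda>x\<in>topspace \<X>. P x ^ n) \<in> p"
    using Suc.prems unfolding power_Suc .
  ultimately show ?case
    using I_prime[OF P] Suc.IH by blast
qed

lemma primeideal_imp_spec_point:
  assumes p: "primeideal p (R_ring TYPE('k::field) \<X>)"
  shows "\<exists>a\<in>topspace \<X>. p = spec_point TYPE('k) \<X> a"
proof -
  let ?R = "R_ring TYPE('k) \<X>"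
  interpret primeideal p ?R
    by (rule p)
  have p_carrier: "P \<in> carrier ?R" if "P \<in> p" for P
    using that Icarr by blast
  let ?S = "{a \<in> topspace \<X>. p \<subseteq> spec_point TYPE('k) \<X> a}"
  have nonvanishing: "\<exists>P\<in>p. P b \<noteq> 0" if "b \<in> topspace \<X> - ?S" for b
    using that p_carrier unfolding spec_point_eq by blast
  have "?S \<noteq> {}"
  proof
    assume "?S = {}"
    then obtain Q where Q: "Q \<in> p" "\<forall>b\<in>topspace \<X>. Q b \<noteq> 0"
      using ideal_nonvanishing_element[OF is_ideal finite_topspace order_refl] nonvanishing by blast
    then obtain Z where "Z \<in> carrier ?R" "Z \<otimes>\<^bsub>?R\<^esub> Q = \<one>\<^bsub>?R\<^esub>"
      using R_ring_nonvanishing_unit[OF p_carrier[OF Q(1)]] by blast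
    then have "\<one>\<^bsub>?R\<^esub> \<in> p"
      using I_l_closed[OF Q(1)] by metis
    then show False
      using one_imp_carrier I_notcarr by blast
  qed
  moreover have "finite ?S"
    using finite_topspace by simp
  \<comment> \<open>A point of \<open>?S\<close> of maximal height: its proper generizations lie
    outside \<open>?S\<close>, so for each of them \<open>p\<close> has an element that does not
    vanish there.\<close>
  ultimately have "Max ((\<lambda>a. card (specializations \<X> a)) ` ?S) \<in> (\<lambda>a. card (specializations \<X> a)) ` ?S"
    by (intro Max_in) auto
  then obtain a where a: "a \<in> ?S" "card (specializations \<X> a) = Max ((\<lambda>a. card (specializations \<X> a)) ` ?S)"
    by (metis (no_types, lifting) imageE)
  have max: "card (specializations \<X> b) \<le> card (specializations \<X> a)" if "b \<in> ?S" for b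
    unfolding a(2) using \<open>finite ?S\<close> that by (intro Max_ge) auto
  let ?B = "{b. a \<in> specializations \<X> b}"
  have B: "b \<in> topspace \<X> - ?S" if "b \<in> ?B" for b
  proof -
    have "a \<in> specializations \<X> b"
      using that by blast
    then show ?thesis
      using max[of b] card_specializations_less[of a b] specializations_iff[of a \<X> b] by force
  qed
  then have B_top: "?B \<subseteq> topspace \<X>"
    by blast
  have "\<exists>Q\<in>p. \<forall>b\<in>?B. Q b \<noteq> 0"
    by (rule ideal_nonvanishing_element[OF is_ideal finite_subset[OF B_top finite_topspace] B_top])
      (use B nonvanishing in blast)
  then obtain Q where Q: "Q \<in> p" "\<forall>b\<in>?B. Q b \<noteq> 0"
    by blast
  have vanish: "P a = 0" if "P \<in> p" for P
    using a(1) that unfolding spec_point_eq by blast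
  have "P \<in> p" if P: "P \<in> carrier ?R" "P a = 0" for P
  proof -
    let ?t = "open_section (insert a ?B) :: 'a \<Rightarrow> ('a set, 'k) ratfun"
    have aX: "a \<in> topspace \<X>"
      using a(1) by blast
    have t: "?t \<in> carrier ?R"
      by (rule open_section_in_R_ring[OF open_upset[OF aX]])
    obtain n Z where Z: "Z \<in> carrier ?R"
      "(\<lambda>x\<in>topspace \<X>. (?t x * P x) ^ n) = Z \<otimes>\<^bsub>?R\<^esub> Q"
      using power_divisible[OF aX P p_carrier[OF Q(1)] vanish[OF Q(1)]] Q(2) by blast
    have "(\<lambda>x\<in>topspace \<X>. (?t \<otimes>\<^bsub>?R\<^esub> P) x ^ n) = Z \<otimes>\<^bsub>?R\<^esub> Q"
      unfolding Z(2)[symmetric] by (simp cong: restrict_cong)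
    then have "(\<lambda>x\<in>topspace \<X>. (?t \<otimes>\<^bsub>?R\<^esub> P) x ^ n) \<in> p"
      using I_l_closed[OF Q(1) Z(1)] by metis
    then have "?t \<otimes>\<^bsub>?R\<^esub> P \<in> p"
      by (rule primeideal_power[OF p m_closed[OF t P(1)]])
    \<comment> \<open>The value of \<open>?t\<close> at \<open>a\<close> is an indeterminate, while
      all elements of \<open>p\<close> vanish at \<open>a\<close>.\<close>
    moreover have "?t \<notin> p"
      using vanish[of ?t] aX by (auto simp: open_section_def)
    ultimately show ?thesis
      using I_prime[OF t P(1)] by blast
  qed
  then have "p = spec_point TYPE('k) \<X> a"
    using a(1) unfolding spec_point_eq by blast
  then show ?thesis
    using a(1) by blast
qed

text \<open>Zero sets are stable under specialization, which gives continuity. The elements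
  \<open>open_section U\<close> separate points by T0 and show that images of open sets are
  open.\<close>

lemma homeomorphic_map_spec_point:
  "homeomorphic_map \<X> (Spec (R_ring TYPE('k::field) \<X>)) (spec_point TYPE('k) \<X>)"
proof (rule bijective_open_imp_homeomorphic_map)
  let ?R = "R_ring TYPE('k) \<X>" and ?g = "spec_point TYPE('k) \<X>"
  show surj: "?g ` topspace \<X> = topspace (Spec ?R)"
    unfolding topspace_Spec using primeideal_imp_spec_point[where 'k = 'k] primeideal_spec_point[where 'k = 'k] by auto
  have open_section_iff: "open_section U \<in> ?g a \<longleftrightarrow> a \<notin> U" if "openin \<X> U" "a \<in> topspace \<X>" for U a
  proof -
    have "open_section U \<in> carrier ?R"
      by (rule open_section_in_R_ring[OF that(1)])
    then show ?thesis
      unfolding spec_point_eq using that(2) by (simp add: open_section_def)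
  qed
  show "inj_on ?g (topspace \<X>)"
  proof (rule inj_onI)
    fix a b
    assume ab: "a \<in> topspace \<X>" "b \<in> topspace \<X>" "?g a = ?g b"
    then have "a \<in> U \<longleftrightarrow> b \<in> U" if "openin \<X> U" for U
      using open_section_iff[OF that] by blast
    then show "a = b"
      using ab(1,2) t0 unfolding t0_space_def by blast
  qed
  show "continuous_map \<X> (Spec ?R) ?g"
    unfolding continuous_map_def
  proof (intro conjI allI impI)
    show "?g \<in> topspace \<X> \<rightarrow> topspace (Spec ?R)"
      using surj by blast
    fix \<V>
    assume "openin (Spec ?R) \<V>"
    then obtain S where S: "S \<subseteq> carrier ?R" "\<V> = {p. primeideal p ?R \<and> \<not> S \<subseteq> p}"
      unfolding openin_Spec by blast
    have eq: "{x \<in> topspace \<X>. ?g x \<in> \<V>} = {x \<in> topspace \<X>. \<exists>P\<in>S. P x \<noteq> 0}"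
      using S primeideal_spec_point[where 'k = 'k] unfolding spec_point_eq by blast
    show "openin \<X> {x \<in> topspace \<X>. ?g x \<in> \<V>}"
      unfolding eq
    proof (rule openin_generalizing)
      fix x s
      assume "s \<in> {x \<in> topspace \<X>. \<exists>P\<in>S. P x \<noteq> 0}" "s \<in> specializations \<X> x"
      moreover from this have "x \<in> topspace \<X>"
        by (simp only: specializations_iff)
      ultimately show "x \<in> {x \<in> topspace \<X>. \<exists>P\<in>S. P x \<noteq> 0}"
        using spec_point_specialization[where 'k = 'k] S(1) by blast
    qed blast
  qed
  show "open_map \<X> (Spec ?R) ?g"
    unfolding open_map_def
  proof (intro allI impI)
    fix U
    assume U: "openin \<X> U"
    \<comment> \<open>All elements supported on \<open>U\<close>: they lie in the kernel at every
      point outside \<open>U\<close>, whereas \<open>open_section U\<close> avoids the kernel at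
      every point of \<open>U\<close>.\<close>
    define S where "S = {P \<in> carrier ?R. \<forall>x\<in>topspace \<X> - U. P x = 0}"
    have t: "open_section U \<in> S"
      unfolding S_def using open_section_in_R_ring[OF U, where 'k = 'k] by (simp add: open_section_def)
    have "\<not> S \<subseteq> ?g a \<longleftrightarrow> a \<in> U" if "a \<in> topspace \<X>" for a
    proof
      show "a \<in> U \<Longrightarrow> \<not> S \<subseteq> ?g a"
        using t open_section_iff[OF U that] by blast
      show "\<not> S \<subseteq> ?g a \<Longrightarrow> a \<in> U"
        using that unfolding S_def spec_point_eq by blast
    qed
    then have "?g ` U = {p. primeideal p ?R \<and> \<not> S \<subseteq> p}"
      using primeideal_imp_spec_point[where 'k = 'k] primeideal_spec_point[where 'k = 'k] openin_subset[OF U]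
      by blast
    moreover have "S \<subseteq> carrier ?R"
      unfolding S_def by blast
    ultimately show "openin (Spec ?R) (?g ` U)"
      unfolding openin_Spec by blast
  qed
qed

end

section \<open>Renaming indeterminates\<close>

definition rename :: "('v \<Rightarrow> 'w) \<Rightarrow> ('v, 'k::field) mpoly \<Rightarrow> ('w, 'k) mpoly" where
  "rename g = mpoly_eval mpoly_const (\<lambda>v. mpoly_var (g v))"

lemma coeff_hom_mpoly_const: "coeff_hom mpoly_const"
  by unfold_locales (simp_all add: mpoly_const_hom)

lemma rename_simps:
  "rename g (p + q) = rename g p + rename g q"
  "rename g (p * q) = rename g p * rename g q"
  "rename g 1 = 1"
  "rename g (mpoly_const a) = mpoly_const a"
  "rename g (mpoly_var v) = mpoly_var (g v)"
  unfolding rename_def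
  by (rule coeff_hom.mpoly_eval_add coeff_hom.mpoly_eval_mult coeff_hom.mpoly_eval_one
      coeff_hom.mpoly_eval_const coeff_hom.mpoly_eval_var, rule coeff_hom_mpoly_const)+

lemma rename_0: "rename g 0 = 0"
  using rename_simps(4)[of g 0] by (simp add: mpoly_const_hom)

text \<open>Renaming back shows injectivity on \<open>mpolys N\<close>, even when \<open>g\<close>
  identifies indeterminates outside \<open>N\<close>.\<close>

lemma rename_inv_into:
  assumes "inj_on g N" "p \<in> mpolys N"
  shows "rename (inv_into N g) (rename g p) = p"
  using assms(2) by induction (simp_all add: rename_simps assms(1))

lemma rename_nonzero:
  assumes "inj_on g N" "p \<in> mpolys N" "p \<noteq> 0"
  shows "rename g p \<noteq> 0"
proof
  assume "rename g p = 0"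
  then show False
    using rename_inv_into[OF assms(1,2)] assms(3) by (simp add: rename_0)
qed

definition fraction_hom :: "('v \<Rightarrow> 'w) \<Rightarrow> ('v, 'k::field) ratfun \<Rightarrow> ('w, 'k) ratfun" where
  "fraction_hom g = frac_ext (\<lambda>p. Fract (rename g p) 1)"

interpretation rename: idom_hom "\<lambda>p. Fract (rename g p) 1" for g
  by unfold_locales (simp_all add: rename_simps One_fract_def)

text \<open>Places the denominator in \<open>mpolys N\<close>, where a renaming that is injective on
  \<open>N\<close> cannot kill it.\<close>

lemma adjoin_fraction:
  assumes "P \<in> adjoin (indet ` N)"
  shows "\<exists>a\<in>mpolys N. \<exists>b\<in>mpolys N. b \<noteq> 0 \<and> P = Fract a b"
  using assms
proof (induction rule: adjoin_induct)
  case (const c)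
  show ?case
    using mpolys.const[of 1 N]
    by (intro bexI[of _ "mpoly_const c"] bexI[of _ 1]) (auto simp: const_def mpoly_const_hom intro: mpolys.const)
next
  case (incl P)
  then obtain v where "v \<in> N" "P = indet v"
    by blast
  then show ?case
    using mpolys.const[of 1 N]
    by (intro bexI[of _ "mpoly_var v"] bexI[of _ 1]) (auto simp: indet_def mpoly_const_hom intro: mpolys.var)
next
  case (add P P')
  then obtain a b a' b' where "a \<in> mpolys N" "b \<in> mpolys N" "b \<noteq> 0" "P = Fract a b"
    "a' \<in> mpolys N" "b' \<in> mpolys N" "b' \<noteq> 0" "P' = Fract a' b'"
    by blast
  then show ?case
    by (intro bexI[of _ "a * b' + a' * b"] bexI[of _ "b * b'"]) (auto intro: mpolys.intros)
next
  case (mult P P')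
  then obtain a b a' b' where "a \<in> mpolys N" "b \<in> mpolys N" "b \<noteq> 0" "P = Fract a b"
    "a' \<in> mpolys N" "b' \<in> mpolys N" "b' \<noteq> 0" "P' = Fract a' b'"
    by blast
  then show ?case
    by (intro bexI[of _ "a * a'"] bexI[of _ "b * b'"]) (auto intro: mpolys.intros)
next
  case (inverse P)
  then obtain a b where "a \<in> mpolys N" "b \<in> mpolys N" "b \<noteq> 0" "P = Fract a b"
    by blast
  moreover from this have "a \<noteq> 0"
    using inverse(2) by (auto simp: Zero_fract_def eq_fract)
  ultimately show ?case
    by (intro bexI[of _ b] bexI[of _ a]) auto
qed

text \<open>Homomorphisms over \<open>'k\<close> on a subset of the ambient field, without a
  prescribed target, so that they restrict and compose freely. 0 and 1 are covered as
  constants.\<close>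

definition hom_on :: "('v, 'k::field) ratfun set \<Rightarrow> (('v, 'k) ratfun \<Rightarrow> ('w, 'k) ratfun) \<Rightarrow> bool" where
  "hom_on A \<phi> \<longleftrightarrow> (\<forall>c. \<phi> (const c) = const c) \<and>
     (\<forall>P\<in>A. \<forall>Q\<in>A. \<phi> (P + Q) = \<phi> P + \<phi> Q \<and> \<phi> (P * Q) = \<phi> P * \<phi> Q)"

lemma fraction_hom_indet: "fraction_hom g (indet v) = indet (g v)"
  by (simp add: fraction_hom_def indet_def rename.frac_ext_Fract rename_simps flip: One_fract_def)

lemma hom_on_fraction_hom:
  assumes "inj_on g N"
  shows "hom_on (adjoin (indet ` N)) (fraction_hom g :: ('v, 'k::field) ratfun \<Rightarrow> ('w, 'k) ratfun)"
proof -
  have "P \<in> idom_hom.regular (\<lambda>p. Fract (rename g p) 1)" if P: "P \<in> adjoin (indet ` N)" for P :: "('v, 'k) ratfun"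
  proof -
    obtain a b where b: "b \<in> mpolys N" "b \<noteq> 0" "P = Fract a b"
      using adjoin_fraction[OF P] by blast
    have "rename g b \<noteq> 0"
      by (rule rename_nonzero[OF assms b(1,2)])
    then show ?thesis
      unfolding b(3) by (intro rename.regularI) (simp add: Zero_fract_def eq_fract)
  qed
  moreover have "fraction_hom g (const c) = const c" for c :: 'k
    by (simp add: fraction_hom_def const_def rename.frac_ext_Fract rename_simps flip: One_fract_def)
  ultimately show ?thesis
    by (simp add: hom_on_def fraction_hom_def rename.frac_ext_add rename.frac_ext_mult)
qed

lemma hom_onD:
  assumes "hom_on A \<phi>"
  shows "\<phi> (const c) = const c" "\<phi> 1 = 1" "\<phi> 0 = 0"
    and "P \<in> A \<Longrightarrow> Q \<in> A \<Longrightarrow> \<phi> (P + Q) = \<phi> P + \<phi> Q"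
    and "P \<in> A \<Longrightarrow> Q \<in> A \<Longrightarrow> \<phi> (P * Q) = \<phi> P * \<phi> Q"
proof -
  show c: "\<phi> (const c) = const c" for c
    using assms by (simp add: hom_on_def)
  show "\<phi> 1 = 1" "\<phi> 0 = 0"
    using c[of 1] c[of 0] by (simp_all add: const_1 const_0)
qed (use assms in \<open>auto simp: hom_on_def\<close>)

lemma hom_on_subset: "hom_on B \<phi> \<Longrightarrow> A \<subseteq> B \<Longrightarrow> hom_on A \<phi>"
  unfolding hom_on_def by blast

lemma hom_on_nonzero:
  assumes "hom_on (adjoin S) \<phi>" "P \<in> adjoin S" "P \<noteq> 0"
  shows "\<phi> P \<noteq> 0" "\<phi> (inverse P) = inverse (\<phi> P)"
proof -
  have "\<phi> P * \<phi> (inverse P) = 1"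
    using hom_onD(5)[OF assms(1,2) adjoin_inverse[OF assms(2)]] assms(3) hom_onD(2)[OF assms(1)] by simp
  then show "\<phi> P \<noteq> 0" "\<phi> (inverse P) = inverse (\<phi> P)"
    by (auto simp: inverse_unique)
qed

text \<open>Inverses are respected automatically, so values on generators determine the map on the
  field; this is the uniqueness behind \<open>point_hom\<close>.\<close>

lemma hom_on_eqI:
  assumes "hom_on (adjoin S) \<phi>" "hom_on (adjoin S) \<psi>" "\<And>P. P \<in> S \<Longrightarrow> \<phi> P = \<psi> P" "P \<in> adjoin S"
  shows "\<phi> P = \<psi> P"
  using assms(4)
  by (induction rule: adjoin_induct)
    (simp_all add: assms(3) hom_onD[OF assms(1)] hom_onD[OF assms(2)]
      hom_on_nonzero[OF assms(1)] hom_on_nonzero[OF assms(2)])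

lemma hom_on_mem:
  assumes "hom_on (adjoin S) \<phi>" "\<And>P. P \<in> S \<Longrightarrow> \<phi> P \<in> adjoin T" "P \<in> adjoin S"
  shows "\<phi> P \<in> adjoin T"
  using assms(3)
  by (induction rule: adjoin_induct)
    (simp_all add: assms(2) hom_onD[OF assms(1)] hom_on_nonzero[OF assms(1)] adjoin_closed)

section \<open>Functoriality\<close>

locale kolmogoroff_surjection = X: kolmogoroff \<X> + Y: kolmogoroff \<Y>
  for \<X> :: "'a topology" and \<Y> :: "'b topology" +
  fixes f :: "'a \<Rightarrow> 'b"
  assumes surj: "continuous_surjection \<X> \<Y> f"
begin

abbreviation preim :: "'b set \<Rightarrow> 'a set" where
  "preim V \<equiv> {u \<in> topspace \<X>. f u \<in> V}"

lemma openin_preim: "openin \<Y> V \<Longrightarrow> openin \<X> (preim V)"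
  using surj by (simp add: continuous_surjection_def continuous_map)

lemma f_topspace: "x \<in> topspace \<X> \<Longrightarrow> f x \<in> topspace \<Y>"
  using surj by (auto simp: continuous_surjection_def)

text \<open>By surjectivity an open set is the image of its preimage.\<close>

lemma inj_on_preim: "inj_on preim {V. openin \<Y> V \<and> y \<in> V}"
proof (rule inj_onI)
  fix V W
  assume "V \<in> {V. openin \<Y> V \<and> y \<in> V}" "W \<in> {V. openin \<Y> V \<and> y \<in> V}" "preim V = preim W"
  moreover have "f ` preim U = U" if "openin \<Y> U" for U
    using surj openin_subset[OF that] by (auto simp: continuous_surjection_def)
  ultimately show "V = W"
    by (metis (no_types, lifting) mem_Collect_eq)
qed

lemma specializations_image:
  assumes s: "s \<in> specializations \<X> x" and "f s \<noteq> f x"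
  shows "f s \<in> specializations \<Y> (f x)"
  unfolding specializations_iff
proof (intro conjI allI impI)
  have *: "s \<in> topspace \<X>" "x \<in> topspace \<X>" "\<And>U. openin \<X> U \<Longrightarrow> s \<in> U \<Longrightarrow> x \<in> U"
    using s by (auto simp only: specializations_iff)
  then show "f s \<in> topspace \<Y>" "f x \<in> topspace \<Y>"
    using f_topspace by blast+
  show "f x \<in> V" if "openin \<Y> V \<and> f s \<in> V" for V
    using *(3)[OF openin_preim, of V] that *(1) by blast
qed (rule assms(2))

text \<open>The property that \<open>point_hom\<close> selects by \<open>THE\<close>, named so that
  existence and uniqueness can be stated.\<close>

definition is_point_hom :: "'a \<Rightarrow> (('b set, 'k::field) ratfun \<Rightarrow> ('a set, 'k) ratfun) \<Rightarrow> bool" where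
  "is_point_hom x \<phi> \<longleftrightarrow> \<phi> \<in> extensional (point_field \<Y> (f x)) \<and>
     \<phi> \<in> ring_hom (point_ring \<Y> (f x)) (point_ring \<X> x) \<and>
     (\<forall>c. \<phi> (const c) = const c) \<and>
     (\<forall>V. openin \<Y> V \<and> f x \<in> V \<longrightarrow> \<phi> (indet V) = indet (preim V))"

lemma is_point_homD:
  assumes "is_point_hom x \<phi>"
  shows "\<phi> \<in> extensional (point_field \<Y> (f x))" "hom_on (point_field \<Y> (f x)) \<phi>"
    and "openin \<Y> V \<Longrightarrow> f x \<in> V \<Longrightarrow> \<phi> (indet V) = indet (preim V)"
    and "P \<in> point_field \<Y> (f x) \<Longrightarrow> \<phi> P \<in> point_field \<X> x"
proof -
  have hom: "\<phi> \<in> ring_hom (point_ring \<Y> (f x)) (point_ring \<X> x)" and const: "\<forall>c. \<phi> (const c) = const c"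
    using assms by (simp_all add: is_point_hom_def)
  show "\<phi> \<in> extensional (point_field \<Y> (f x))"
    using assms by (simp add: is_point_hom_def)
  show "openin \<Y> V \<Longrightarrow> f x \<in> V \<Longrightarrow> \<phi> (indet V) = indet (preim V)"
    using assms by (simp add: is_point_hom_def)
  show "hom_on (point_field \<Y> (f x)) \<phi>"
    using const ring_hom_mult[OF hom] ring_hom_add[OF hom] by (simp add: hom_on_def)
  show "P \<in> point_field \<Y> (f x) \<Longrightarrow> \<phi> P \<in> point_field \<X> x"
    using ring_hom_closed[OF hom, of P] by simp
qed

text \<open>The second map is any homomorphism on the field with the right values on indeterminates,
  so identities, composites and embeddings at other points can be compared with the selected
  one.\<close>

lemma is_point_hom_eqI:
  assumes \<phi>: "is_point_hom x \<phi>" and \<psi>: "hom_on (point_field \<Y> (f x)) \<psi>"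
    "\<And>V. openin \<Y> V \<Longrightarrow> f x \<in> V \<Longrightarrow> \<psi> (indet V) = indet (preim V)"
    and P: "P \<in> point_field \<Y> (f x)"
  shows "\<phi> P = \<psi> P"
proof (rule hom_on_eqI[OF is_point_homD(2)[OF \<phi>, unfolded point_field_def]
      \<psi>(1)[unfolded point_field_def] _ P[unfolded point_field_def]])
  show "\<phi> P = \<psi> P" if "P \<in> {indet V |V. openin \<Y> V \<and> f x \<in> V}" for P
    using that is_point_homD(3)[OF \<phi>] \<psi>(2) by force
qed

lemma is_point_hom_exists:
  assumes x: "x \<in> topspace \<X>"
  shows "is_point_hom x (restrict (fraction_hom preim) (point_field \<Y> (f x))
    :: ('b set, 'k::field) ratfun \<Rightarrow> ('a set, 'k) ratfun)" (is "is_point_hom x (restrict ?h ?A)")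
proof -
  have eq: "?A = adjoin (indet ` {V. openin \<Y> V \<and> f x \<in> V})"
    unfolding point_field_def by (rule arg_cong[where f = adjoin]) blast
  have hom: "hom_on ?A ?h"
    unfolding eq by (rule hom_on_fraction_hom[OF inj_on_preim])
  have gen: "?h P \<in> adjoin {indet U | U. openin \<X> U \<and> x \<in> U}"
    if "P \<in> indet ` {V. openin \<Y> V \<and> f x \<in> V}" for P
  proof -
    obtain V where V: "P = indet V" "openin \<Y> V" "f x \<in> V"
      using \<open>P \<in> _\<close> by blast
    then have "openin \<X> (preim V)" "x \<in> preim V"
      using x openin_preim by simp_all
    then show ?thesis
      unfolding V(1) fraction_hom_indet by (intro adjoin_incl) blast
  qed
  have mem: "?h P \<in> point_field \<X> x" if P: "P \<in> ?A" for P
    unfolding point_field_def[of \<X>]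
    by (rule hom_on_mem[OF hom[unfolded eq] gen P[unfolded eq]])
  have "restrict ?h ?A \<in> ring_hom (point_ring \<Y> (f x)) (point_ring \<X> x)"
    using hom_onD[OF hom] mem by (intro ring_hom_memI) (simp_all add: point_field_closed)
  then show ?thesis
    unfolding is_point_hom_def
    by (simp add: hom_onD[OF hom] fraction_hom_indet indet_in_point_field point_field_closed)
qed

lemma is_point_hom_point_hom:
  assumes x: "x \<in> topspace \<X>"
  shows "is_point_hom x (point_hom \<X> \<Y> f x :: ('b set, 'k::field) ratfun \<Rightarrow> ('a set, 'k) ratfun)"
proof -
  let ?h = "restrict (fraction_hom preim) (point_field \<Y> (f x)) :: ('b set, 'k) ratfun \<Rightarrow> ('a set, 'k) ratfun"
  have h: "is_point_hom x ?h"
    by (rule is_point_hom_exists[OF x])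
  have "\<phi> = ?h" if \<phi>: "is_point_hom x \<phi>" for \<phi>
  proof (rule extensionalityI[OF is_point_homD(1)[OF \<phi>] is_point_homD(1)[OF h]])
    show "\<phi> P = ?h P" if "P \<in> point_field \<Y> (f x)" for P
      by (rule is_point_hom_eqI[OF \<phi> is_point_homD(2,3)[OF h] that])
  qed
  with h have "is_point_hom x (THE \<phi>. is_point_hom x (\<phi> :: ('b set, 'k) ratfun \<Rightarrow> ('a set, 'k) ratfun))"
    by (rule theI)
  then show ?thesis
    by (simp add: point_hom_def is_point_hom_def)
qed

lemmas point_hom = is_point_homD(2-4)[OF is_point_hom_point_hom]
  and point_hom_eqI = is_point_hom_eqI[OF is_point_hom_point_hom]

lemma point_hom_eq_0_iff:
  assumes "x \<in> topspace \<X>" "P \<in> point_field \<Y> (f x)"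
  shows "point_hom \<X> \<Y> f x P = 0 \<longleftrightarrow> P = 0"
  using hom_on_nonzero(1)[OF point_hom(1)[OF assms(1), unfolded point_field_def]] assms(2)
    hom_onD(3)[OF point_hom(1)[OF assms(1)]]
  unfolding point_field_def by blast

text \<open>Every neighbourhood of \<open>f s\<close> is one of \<open>f x\<close>, and both
  embeddings send its indeterminate to that of its preimage; so they agree on the smaller
  field.\<close>

lemma point_hom_specialization:
  assumes s: "s \<in> specializations \<X> x" and P: "P \<in> point_field \<Y> (f s)"
  shows "point_hom \<X> \<Y> f x P = point_hom \<X> \<Y> f s P"
proof -
  have sx: "s \<in> topspace \<X>" "x \<in> topspace \<X>"
    using s by (auto simp only: specializations_iff)
  have nbhd: "f x \<in> V" if "openin \<Y> V" "f s \<in> V" for V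
    using specializations_image[OF s] that by (cases "f s = f x") (auto simp only: specializations_iff)
  have "point_field \<Y> (f s) \<subseteq> point_field \<Y> (f x)"
    unfolding point_field_def by (rule adjoin_mono) (use nbhd in \<open>auto intro: adjoin_incl\<close>)
  from hom_on_subset[OF point_hom(1)[OF sx(2)] this]
  show ?thesis
    by (rule point_hom_eqI[OF sx(1) _ point_hom(2)[OF sx(2) _ nbhd] P, symmetric])
qed

text \<open>If \<open>f s = f x\<close>, the value already lies in the point field of
  \<open>s\<close> and is its own residue. Otherwise \<open>Q (f x)\<close> is a fraction of
  polynomials over the residue field at \<open>f s\<close>, and the embedding commutes with residues
  on these; being injective, it keeps the residue of the denominator nonzero.\<close>

lemma pullback_gluing:
  fixes Q :: "'b \<Rightarrow> ('b set, 'k::field) ratfun"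
  assumes Q: "Q \<in> carrier (R_ring TYPE('k) \<Y>)" and s: "s \<in> specializations \<X> x"
  defines "\<phi> \<equiv> point_hom \<X> \<Y> f x :: ('b set, 'k) ratfun \<Rightarrow> _"
  shows "0 \<le> val s (\<phi> (Q (f x)))" "reduct s (\<phi> (Q (f x))) = point_hom \<X> \<Y> f s (Q (f s))"
proof -
  have sx: "s \<in> topspace \<X>" "x \<in> topspace \<X>"
    using s by (auto simp only: specializations_iff)
  have Q_mem: "Q (f x) \<in> point_field \<Y> (f x)" "Q (f s) \<in> point_field \<Y> (f s)"
    using Y.R_ringD(1)[OF Q] f_topspace sx by blast+
  note \<phi> = point_hom(1)[OF sx(2), where 'c = 'k, folded \<phi>_def]
  note \<phi>D = hom_onD[OF \<phi>]
  have *: "0 \<le> val s (\<phi> (Q (f x))) \<and> reduct s (\<phi> (Q (f x))) = \<phi> (Q (f s))"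
  proof (cases "f s = f x")
    case True
    then have "\<phi> (Q (f x)) = point_hom \<X> \<Y> f s (Q (f s))"
      using point_hom_specialization[OF s Q_mem(2)] by (simp add: \<phi>_def)
    then have "\<phi> (Q (f x)) \<in> point_field \<X> s"
      using point_hom(3)[OF sx(1) Q_mem(2)] by simp
    then have "\<phi> (Q (f x)) \<in> res_field \<X> x s"
      using X.point_field_specialization_subset[OF s] by blast
    from X.val_res_field[OF s this] X.reduct_res_field[OF s this] show ?thesis
      using True by simp
  next
    case False
    have fs: "f s \<in> specializations \<Y> (f x)"
      by (rule specializations_image[OF s False])
    note res_sub = Y.res_field_subset[OF fs, THEN subsetD]
    have \<phi>_indet: "\<phi> (indet V) = indet (preim V)" if "openin \<Y> V" "f x \<in> V" for V
      unfolding \<phi>_def by (rule point_hom(2)[OF sx(2) that])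
    have nbhd: "f x \<in> V" if "openin \<Y> V" "f s \<in> V" for V
      using fs that by (auto simp only: specializations_iff)
    have inv: "\<phi> (inverse P) = inverse (\<phi> P)" if "P \<in> point_field \<Y> (f x)" for P
      using hom_on_nonzero(2)[OF \<phi>[unfolded point_field_def]] that \<phi>D(3)
      unfolding point_field_def by (cases "P = 0") auto
    \<comment> \<open>Preimages of sets containing \<open>f s\<close> contain \<open>s\<close>, and
      preimages of sets missing \<open>f s\<close> miss \<open>s\<close>; so generators of the
      residue field go to generators.\<close>
    have res: "\<phi> c \<in> res_field \<X> x s" if "c \<in> res_field \<Y> (f x) (f s)" for c
      unfolding res_field_def
    proof (rule hom_on_mem[OF _ _ that[unfolded res_field_def]], fold res_field_def)
      show "hom_on (res_field \<Y> (f x) (f s)) \<phi>"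
        by (rule hom_on_subset[OF \<phi> Y.res_field_subset[OF fs]])
      fix P :: "('b set, 'k) ratfun"
      assume "P \<in> {indet U |U. openin \<Y> U \<and> f s \<in> U} \<union> {indet U / indet V |U V.
        openin \<Y> U \<and> f x \<in> U \<and> f s \<notin> U \<and> openin \<Y> V \<and> f x \<in> V \<and> f s \<notin> V}"
      then show "\<phi> P \<in> res_field \<X> x s"
      proof
        assume "P \<in> {indet U |U. openin \<Y> U \<and> f s \<in> U}"
        then obtain U where U: "P = indet U" "openin \<Y> U" "f s \<in> U"
          by blast
        then have "\<phi> P = indet (preim U)" "openin \<X> (preim U)" "s \<in> preim U"
          using \<phi>_indet nbhd openin_preim sx by auto
        then show ?thesis
          unfolding res_field_def by (intro adjoin_incl) blast
      next
        assume "P \<in> {indet U / indet V |U V.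
          openin \<Y> U \<and> f x \<in> U \<and> f s \<notin> U \<and> openin \<Y> V \<and> f x \<in> V \<and> f s \<notin> V}"
        then obtain U V where UV: "P = indet U * inverse (indet V)"
          "openin \<Y> U" "f x \<in> U" "f s \<notin> U" "openin \<Y> V" "f x \<in> V" "f s \<notin> V"
          by (auto simp: divide_inverse)
        then have "\<phi> P = indet (preim U) / indet (preim V)"
          by (simp add: \<phi>D inv \<phi>_indet indet_in_point_field adjoin_inverse[folded point_field_def]
              point_field_closed divide_inverse)
        moreover have "openin \<X> (preim U)" "openin \<X> (preim V)" "x \<in> preim U" "x \<in> preim V"
          "s \<notin> preim U" "s \<notin> preim V"
          using UV openin_preim sx by auto
        ultimately show ?thesis
          unfolding res_field_def by (intro adjoin_incl) blast
      qed
    qed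
    have polys: "0 \<le> val s (\<phi> a) \<and> reduct s (\<phi> a) = \<phi> (reduct (f s) a)"
      if a: "a \<in> carrier (res_poly_ring \<Y> (f x) (f s))" for a
    proof -
      let ?G = "generate_ring ratfun_ring (res_field \<Y> (f x) (f s) \<union> {unif \<Y> (f x) (f s)})"
      have G: "0 \<le> val (f s) b" "reduct (f s) b \<in> point_field \<Y> (f x)" "b \<in> point_field \<Y> (f x)" if "b \<in> ?G" for b
        using Y.polys_integral[OF fs, of b] that res_sub by (auto simp: res_poly_ring_def)
      have "a \<in> ?G"
        using a by (simp add: res_poly_ring_def)
      then show ?thesis
      proof (induction rule: generate_ring.induct)
        case one
        show ?case
          by (simp add: \<phi>D)
      next
        case (incl h)
        then consider "h = unif \<Y> (f x) (f s)" | "h \<in> res_field \<Y> (f x) (f s)"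
          by blast
        then show ?case
        proof cases
          case 1
          \<comment> \<open>The uniformizer may go to something other than the chosen uniformizer at
            \<open>s\<close>, but the new set misses \<open>s\<close> too, so the residue is again
            0.\<close>
          define V where "V = (SOME U. openin \<Y> U \<and> f x \<in> U \<and> f s \<notin> U)"
          have V: "h = indet V" "openin \<Y> V" "f x \<in> V" "f s \<notin> V"
            using 1 Y.sep[OF fs] by (simp_all add: unif_def V_def)
          then show ?thesis
            by (simp add: \<phi>_indet val_indet reduct_def expand_indet \<phi>D)
        next
          case 2
          then show ?thesis
            using X.val_res_field[OF s res[OF 2]] X.reduct_res_field[OF s res[OF 2]] Y.reduct_res_field[OF fs 2]
            by simp
        qed
      next
        case (a_inv h)
        have "\<phi> (- b) = - \<phi> b" if "b \<in> point_field \<Y> (f x)" for b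
          using \<phi>D(4)[of b "- b"] \<phi>D(3) that
          by (simp add: point_field_closed eq_neg_iff_add_eq_0 add.commute)
        then show ?case
          using a_inv G[OF a_inv(1)] by simp
      next
        case (eng_add h1 h2)
        then show ?case
          using G[OF eng_add(1)] G[OF eng_add(2)] by (simp add: \<phi>D integral_add)
      next
        case (eng_mult h1 h2)
        then show ?case
          using G[OF eng_mult(1)] G[OF eng_mult(2)] by (simp add: \<phi>D integral_mult reduct_mult)
      qed
    qed
    have "Q (f x) \<in> carrier (dvr \<Y> (f x) (f s))"
      using Y.R_ringD(2)[OF Q f_topspace[OF sx(2)] fs] Q_mem(1) by (simp add: Y.dvr_iff[OF fs])
    then obtain a b where ab: "Q (f x) = a / b" "reduct (f s) b \<noteq> 0"
      "a \<in> carrier (res_poly_ring \<Y> (f x) (f s))" "b \<in> carrier (res_poly_ring \<Y> (f x) (f s))"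
      unfolding Y.carrier_dvr_eq[OF fs] by blast
    have mem: "a \<in> point_field \<Y> (f x)" "b \<in> point_field \<Y> (f x)"
      "reduct (f s) a \<in> point_field \<Y> (f x)" "reduct (f s) b \<in> point_field \<Y> (f x)"
      using Y.polys_integral[OF fs] ab res_sub by blast+
    have nz: "\<phi> (reduct (f s) b) \<noteq> 0"
      using point_hom_eq_0_iff[OF sx(2) mem(4)] ab(2) by (simp add: \<phi>_def)
    have \<phi>_divide: "\<phi> (P / P') = \<phi> P / \<phi> P'" if "P \<in> point_field \<Y> (f x)" "P' \<in> point_field \<Y> (f x)" for P P'
      using that by (simp add: divide_inverse \<phi>D inv point_field_closed)
    have "Q (f s) = reduct (f s) a / reduct (f s) b"
      using Y.R_ringD(3)[OF Q f_topspace[OF sx(2)] fs] ab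
        integral_divide(2)[OF Y.polys_integral(1)[OF fs ab(3)] Y.polys_integral(1)[OF fs ab(4)] ab(2)] by simp
    then show ?thesis
      using integral_divide[of s "\<phi> a" "\<phi> b"] polys[OF ab(3)] polys[OF ab(4)] nz
      by (simp add: ab(1) \<phi>_divide mem)
  qed
  then show "0 \<le> val s (\<phi> (Q (f x)))"
    by blast
  show "reduct s (\<phi> (Q (f x))) = point_hom \<X> \<Y> f s (Q (f s))"
    using * point_hom_specialization[OF s Q_mem(2)] by (simp add: \<phi>_def)
qed

section \<open>The pullback on the rings and its naturality\<close>

lemma pullback_in_R_ring:
  assumes Q: "Q \<in> carrier (R_ring TYPE('k::field) \<Y>)"
  shows "pullback \<X> \<Y> f Q \<in> carrier (R_ring TYPE('k) \<X>)"
  unfolding pullback_def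
proof (rule X.R_ringI)
  show "point_hom \<X> \<Y> f x (Q (f x)) \<in> point_field \<X> x" if "x \<in> topspace \<X>" for x
    using point_hom(3)[OF that] Y.R_ringD(1)[OF Q f_topspace[OF that]] by blast
qed (use pullback_gluing[OF Q] in auto)

lemma ring_hom_cring_pullback:
  "ring_hom_cring (R_ring TYPE('k::field) \<Y>) (R_ring TYPE('k) \<X>) (pullback \<X> \<Y> f)"
proof (rule ring_hom_cring.intro[OF Y.cring_R_ring X.cring_R_ring ring_hom_cring_axioms.intro])
  show "pullback \<X> \<Y> f \<in> ring_hom (R_ring TYPE('k) \<Y>) (R_ring TYPE('k) \<X>)"
  proof (rule ring_hom_memI)
    fix P Q
    assume PQ: "P \<in> carrier (R_ring TYPE('k) \<Y>)" "Q \<in> carrier (R_ring TYPE('k) \<Y>)"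
    show "pullback \<X> \<Y> f P \<in> carrier (R_ring TYPE('k) \<X>)"
      by (rule pullback_in_R_ring[OF PQ(1)])
    have mem: "P (f x) \<in> point_field \<Y> (f x)" "Q (f x) \<in> point_field \<Y> (f x)" if "x \<in> topspace \<X>" for x
      using Y.R_ringD(1)[OF _ f_topspace[OF that]] PQ by blast+
    show "pullback \<X> \<Y> f (P \<otimes>\<^bsub>R_ring TYPE('k) \<Y>\<^esub> Q)
        = pullback \<X> \<Y> f P \<otimes>\<^bsub>R_ring TYPE('k) \<X>\<^esub> pullback \<X> \<Y> f Q"
      "pullback \<X> \<Y> f (P \<oplus>\<^bsub>R_ring TYPE('k) \<Y>\<^esub> Q)
        = pullback \<X> \<Y> f P \<oplus>\<^bsub>R_ring TYPE('k) \<X>\<^esub> pullback \<X> \<Y> f Q"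
      using mem by (auto simp: pullback_def restrict_def fun_eq_iff f_topspace hom_onD[OF point_hom(1)])
  next
    show "pullback \<X> \<Y> f \<one>\<^bsub>R_ring TYPE('k) \<Y>\<^esub> = \<one>\<^bsub>R_ring TYPE('k) \<X>\<^esub>"
      by (auto simp: pullback_def restrict_def fun_eq_iff f_topspace hom_onD[OF point_hom(1)])
  qed
qed

text \<open>A homomorphism of fields is injective, so the pullback of a family vanishes at
  \<open>x\<close> exactly when the family vanishes at \<open>f x\<close>.\<close>

lemma Spec_map_pullback_spec_point:
  assumes x: "x \<in> topspace \<X>"
  shows "Spec_map (R_ring TYPE('k::field) \<Y>) (pullback \<X> \<Y> f) (spec_point TYPE('k) \<X> x)
    = spec_point TYPE('k) \<Y> (f x)"
proof -
  have "pullback \<X> \<Y> f Q x = 0 \<longleftrightarrow> Q (f x) = 0" if "Q \<in> carrier (R_ring TYPE('k) \<Y>)" for Q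
    using point_hom_eq_0_iff[OF x Y.R_ringD(1)[OF that f_topspace[OF x]]] x by (simp add: pullback_def)
  then show ?thesis
    unfolding Spec_map_def X.spec_point_eq Y.spec_point_eq using pullback_in_R_ring[where 'k = 'k] by blast
qed

end

lemma pullback_id:
  assumes "finite_kolmogoroff \<X>" and P: "P \<in> carrier (R_ring TYPE('k::field) \<X>)"
  shows "pullback \<X> \<X> id P = P"
proof -
  interpret kolmogoroff_surjection \<X> \<X> id
    by unfold_locales (use assms in \<open>simp_all add: continuous_surjection_def\<close>)
  have "point_hom \<X> \<X> id x (P x) = P x" if x: "x \<in> topspace \<X>" for x
  proof -
    have "point_hom \<X> \<X> id x (P x) = (\<lambda>Q. Q) (P x)"
    proof (rule point_hom_eqI[OF x])
      show "indet V = indet {u \<in> topspace \<X>. id u \<in> V}" if "openin \<X> V" for V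
        using openin_subset[OF that] by (intro arg_cong[where f = indet]) auto
    qed (use X.R_ringD(1)[OF P x] in \<open>simp_all add: hom_on_def\<close>)
    then show ?thesis .
  qed
  then show ?thesis
    using X.R_ring_extensional[OF P] unfolding pullback_def by (intro extensionalityI[of _ "topspace \<X>"]) auto
qed

text \<open>The composite of the two embeddings has the values that characterize the embedding for
  the composite map, because preimages compose.\<close>

lemma pullback_comp:
  assumes "finite_kolmogoroff \<X>" "finite_kolmogoroff \<Y>" "finite_kolmogoroff \<Z>"
    and "continuous_surjection \<X> \<Y> f" "continuous_surjection \<Y> \<Z> g"
    and P: "P \<in> carrier (R_ring TYPE('k::field) \<Z>)"
  shows "pullback \<X> \<Z> (g \<circ> f) P = pullback \<X> \<Y> f (pullback \<Y> \<Z> g P)"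
proof -
  interpret f: kolmogoroff_surjection \<X> \<Y> f
    by unfold_locales (use assms in simp_all)
  interpret g: kolmogoroff_surjection \<Y> \<Z> g
    by unfold_locales (use assms in simp_all)
  interpret gf: kolmogoroff_surjection \<X> \<Z> "g \<circ> f"
  proof unfold_locales
    show "continuous_surjection \<X> \<Z> (g \<circ> f)"
      using assms(4,5) unfolding continuous_surjection_def
      by (metis continuous_map_compose image_comp)
  qed
  have "point_hom \<X> \<Z> (g \<circ> f) x (P (g (f x))) = point_hom \<X> \<Y> f x (point_hom \<Y> \<Z> g (f x) (P (g (f x))))"
    if x: "x \<in> topspace \<X>" for x
  proof (rule gf.point_hom_eqI[OF x, where P = "P (g (f x))"])
    note y = f.f_topspace[OF x]
    note hf = hom_onD[OF f.point_hom(1)[OF x]] and hg = hom_onD[OF g.point_hom(1)[OF y]]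
    show "hom_on (point_field \<Z> ((g \<circ> f) x)) (\<lambda>Q. point_hom \<X> \<Y> f x (point_hom \<Y> \<Z> g (f x) Q))"
      by (simp add: hom_on_def hf hg g.point_hom(3)[OF y])
    show "P (g (f x)) \<in> point_field \<Z> ((g \<circ> f) x)"
      using g.Y.R_ringD(1)[OF P] g.f_topspace[OF y] by simp
    fix V
    assume V: "openin \<Z> V" "(g \<circ> f) x \<in> V"
    have "{u \<in> topspace \<X>. f u \<in> {u \<in> topspace \<Y>. g u \<in> V}} = {u \<in> topspace \<X>. (g \<circ> f) u \<in> V}"
      using f.f_topspace by auto
    then show "point_hom \<X> \<Y> f x (point_hom \<Y> \<Z> g (f x) (indet V)) = indet {u \<in> topspace \<X>. (g \<circ> f) u \<in> V}"
      using V y by (simp add: g.point_hom(2)[OF y V(1)] f.point_hom(2)[OF x g.openin_preim[OF V(1)]])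
  qed
  then show ?thesis
    using f.f_topspace by (auto simp: pullback_def restrict_def fun_eq_iff)
qed

theorem theorem1:
  shows
    "(\<forall>\<X> :: 'a topology. finite_kolmogoroff \<X> \<longrightarrow>
        homeomorphic_map \<X> (Spec (R_ring TYPE('k::field) \<X>)) (spec_point TYPE('k) \<X>))
   \<and> (\<forall>(\<X> :: 'a topology) (\<Y> :: 'b topology) f.
        finite_kolmogoroff \<X> \<and> finite_kolmogoroff \<Y> \<and> continuous_surjection \<X> \<Y> f \<longrightarrow>
        ring_hom_cring (R_ring TYPE('k) \<Y>) (R_ring TYPE('k) \<X>) (pullback \<X> \<Y> f))
   \<and> (\<forall>\<X> :: 'a topology. finite_kolmogoroff \<X> \<longrightarrow>
        (\<forall>P \<in> carrier (R_ring TYPE('k) \<X>). pullback \<X> \<X> id P = P))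
   \<and> (\<forall>(\<X> :: 'a topology) (\<Y> :: 'b topology) (\<Z> :: 'c topology) f g.
        finite_kolmogoroff \<X> \<and> finite_kolmogoroff \<Y> \<and> finite_kolmogoroff \<Z> \<and>
        continuous_surjection \<X> \<Y> f \<and> continuous_surjection \<Y> \<Z> g \<longrightarrow>
        (\<forall>P \<in> carrier (R_ring TYPE('k) \<Z>).
           pullback \<X> \<Z> (g \<circ> f) P = pullback \<X> \<Y> f (pullback \<Y> \<Z> g P)))
   \<and> (\<forall>(\<X> :: 'a topology) (\<Y> :: 'b topology) f.
        finite_kolmogoroff \<X> \<and> finite_kolmogoroff \<Y> \<and> continuous_surjection \<X> \<Y> f \<longrightarrow>
        (\<forall>x \<in> topspace \<X>.
           Spec_map (R_ring TYPE('k) \<Y>) (pullback \<X> \<Y> f) (spec_point TYPE('k) \<X> x)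
             = spec_point TYPE('k) \<Y> (f x)))"
proof -
  have surjection: "kolmogoroff_surjection \<X> \<Y> f"
    if "finite_kolmogoroff \<X> \<and> finite_kolmogoroff \<Y> \<and> continuous_surjection \<X> \<Y> f"
    for \<X> :: "'a topology" and \<Y> :: "'b topology" and f
    by unfold_locales (use that in simp_all)
  show ?thesis
  proof (intro conjI allI impI ballI, goal_cases)
    case 1
    then show ?case
      by (rule kolmogoroff.homeomorphic_map_spec_point[OF kolmogoroff.intro])
  next
    case 2
    then show ?case
      by (rule kolmogoroff_surjection.ring_hom_cring_pullback[OF surjection])
  next
    case 3
    then show ?case
      by (rule pullback_id)
  next
    case 4
    then show ?case
      by (simp add: pullback_comp)
  next
    case 5
    then show ?case
      by (intro kolmogoroff_surjection.Spec_map_pullback_spec_point[OF surjection])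
  qed
qed

end
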